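(* Let $\mathcal{V}$ be the set of all functions $u : \mathbb{R} \to \mathbb{R}$ that are the value function of some two-player zero-sum polynomial game. Then $\mathcal{V}$ coincides with the set of all continuous and piecewise rational functions from $\mathbb{R}$ to $\mathbb{R}$.
   Context: A two-player zero-sum polynomial game is a tuple $\Gamma = (A,B,G)$, where $A$ is the finite nonempty strategy set of Player 1, $B$ is the finite nonempty strategy set of Player 2, and $G = (G_{a,b})_{a\in A, b\in B}$ is a payoff matrix of size $|A|\times|B|$ whose entries are polynomials with real coefficients in one variable $Z$. For every $z\in\mathbb{R}$, $\Gamma(z) = (A,B,G(z))$ denotes the two-player zero-sum strategic-form game (matrix game) with strategy sets $A$ and $B$ and payoffs $G(z) = (G_{a,b}(z))_{a\in A,b\in B}$ (paid to Player 1, who maximizes, by Player 2, who minimizes). Its value is the usual minimax value in mixed strategies, $\mathrm{val}(\Gamma(z)) = \max_{x\in\Delta(A)}\min_{y\in\Delta(B)}\sum_{a\in A,\,b\in B} x_a y_b G_{a,b}(z)$, where $\Delta(S)$ is the set of probability distributions on the finite set $S$. The value function of $\Gamma$ is the function $u:\mathbb{R}\to\mathbb{R}$ given by $u(z) = \mathrm{val}(\Gamma(z))$. A function $u:\mathbb{R}\to\mathbb{R}$ is piecewise rational if there are a natural number $K$, a sequence $-\infty = h_1 < h_2 < \cdots < h_K = \infty$, and rational functions $\left(\tfrac{Q_k}{R_k}\right)_{k=1}^{K-1}$ (with $Q_k,R_k$ real polynomials in one variable) such that $u = \sum_{k=1}^{K-1}\mathbf{1}_{(h_k,h_{k+1}]}\tfrac{Q_k}{R_k}$;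 here, for $k=K-1$, the interval $(h_{K-1},h_K]$ is to be read as $(h_{K-1},\infty)$, and each $\tfrac{Q_k}{R_k}$ has no pole on its interval. *)

theory Defs
  imports "HOL-Analysis.Analysis" "HOL-Computational_Algebra.Polynomial"
    "HOL-Library.Infinite_Typeclass"
begin

text \<open>
  The payoff type \<open>'c\<close> is \<^typ>\<open>real\<close> for a matrix game and \<^typ>\<open>real poly\<close> for a polynomial
  game. Payoffs outside \<open>strategies1 \<times> strategies2\<close> are irrelevant.
  Every finite strategy set embeds into any infinite type, so games over infinite types of
  strategies realise all value functions; over a finite type the number of strategies is bounded.
\<close>

record ('a, 'b, 'c) zero_sum_game =
  strategies1 :: "'a set"
  strategies2 :: "'b set"
  payoff :: "'a \<Rightarrow> 'b \<Rightarrow> 'c"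

type_synonym ('a, 'b) matrix_game = "('a, 'b, real) zero_sum_game"
type_synonym ('a, 'b) polynomial_game = "('a, 'b, real poly) zero_sum_game"

definition finite_game :: "('a, 'b, 'c) zero_sum_game \<Rightarrow> bool" where
  "finite_game \<Gamma> \<longleftrightarrow>
     finite (strategies1 \<Gamma>) \<and> strategies1 \<Gamma> \<noteq> {} \<and>
     finite (strategies2 \<Gamma>) \<and> strategies2 \<Gamma> \<noteq> {}"

definition mixed_strategies :: "'s set \<Rightarrow> ('s \<Rightarrow> real) set" where
  "mixed_strategies S =
     {x. (\<forall>s\<in>S. 0 \<le> x s) \<and> (\<forall>s. s \<notin> S \<longrightarrow> x s = 0) \<and> (\<Sum>s\<in>S. x s) = 1}"

definition expected_payoff ::
    "('a, 'b) matrix_game \<Rightarrow> ('a \<Rightarrow> real) \<Rightarrow> ('b \<Rightarrow> real) \<Rightarrow> real" where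
  "expected_payoff \<Gamma> x y =
     (\<Sum>a\<in>strategies1 \<Gamma>. \<Sum>b\<in>strategies2 \<Gamma>. x a * y b * payoff \<Gamma> a b)"

text \<open>
  For a finite game the sets of mixed strategies are nonempty and compact, and the expected
  payoff is bilinear, so the supremum and the infimum below are a maximum and a minimum.
\<close>

definition val :: "('a, 'b) matrix_game \<Rightarrow> real" where
  "val \<Gamma> =
     (SUP x\<in>mixed_strategies (strategies1 \<Gamma>).
        INF y\<in>mixed_strategies (strategies2 \<Gamma>). expected_payoff \<Gamma> x y)"

definition game_at :: "('a, 'b) polynomial_game \<Rightarrow> real \<Rightarrow> ('a, 'b) matrix_game" where
  "game_at \<Gamma> z =
     \<lparr>strategies1 = strategies1 \<Gamma>, strategies2 = strategies2 \<Gamma>,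
      payoff = (\<lambda>a b. poly (payoff \<Gamma> a b) z)\<rparr>"

definition value_function :: "('a, 'b) polynomial_game \<Rightarrow> real \<Rightarrow> real" where
  "value_function \<Gamma> z = val (game_at \<Gamma> z)"

text \<open>
  The breakpoints are extended reals; as the argument \<open>ereal z\<close> is finite, the last interval
  \<open>{h (K - 1)<..\<infinity>}\<close> contributes exactly \<open>(h (K - 1), \<infinity>)\<close>. A rational function without
  poles on an interval is a quotient \<open>Q / R\<close> of polynomials with \<open>R\<close> nonvanishing there.
\<close>

definition piecewise_rational :: "(real \<Rightarrow> real) \<Rightarrow> bool" where
  "piecewise_rational u \<longleftrightarrow>
     (\<exists>(K::nat) (h :: nat \<Rightarrow> ereal) (Q :: nat \<Rightarrow> real poly) (R :: nat \<Rightarrow> real poly).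
        1 \<le> K \<and> h 1 = -\<infinity> \<and> h K = \<infinity> \<and> strict_mono_on {1..K} h \<and>
        (\<forall>k\<in>{1..<K}. \<forall>z. ereal z \<in> {h k<..h (k + 1)} \<longrightarrow> poly (R k) z \<noteq> 0) \<and>
        u = (\<lambda>z. \<Sum>k=1..<K.
               indicator {h k<..h (k + 1)} (ereal z) * (poly (Q k) z / poly (R k) z)))"

end

theory Submission
  imports Defs
begin

text \<open>
  Value functions are continuous because the value moves by at most \<open>\<epsilon>\<close> when each payoff does.
  They are piecewise rational because the value solves a linear program whose coefficients are
  polynomials in \<open>z\<close>. The set of levels that Player 1 can secure is the projection of a
  polyhedron, and Fourier--Motzkin elimination of the weights describes it by finitely many
  inequalities \<open>0 \<le> \<alpha> z + \<beta> z * v\<close>. The elimination branches on signs that depend on \<open>z\<close>, so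
  \<open>\<alpha>\<close> and \<open>\<beta>\<close> need not be rational, but at each \<open>z\<close> they take the value of one of finitely many
  rational functions (\<open>finitely_rational\<close>). The same then holds for the value, the least zero
  of a decreasing constraint (\<open>polynomial_value_finitely_rational\<close>). Two different rational
  functions cross at finitely many points only. By connectedness, a continuous function that
  selects among them follows one and the same quotient between two consecutive crossings, and
  cancellation removes a pole at an end point (\<open>continuous_finitely_rational_imp_piecewise\<close>).

  Conversely, the class of functions that are the value of a game with explicit saddle points
  (\<open>realizable\<close>) contains the polynomials and is closed under sums, negation, maximum and
  minimum. A quotient without poles on a closed set is there the value of a suitable \<open>2 \<times> 2\<close>
  game (\<open>realizable_quotient_on_closed\<close>); the value of this game outside the set is continuous
  but uncontrolled. It remains to glue two realizable functions that agree at a point \<open>h\<close>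
  (\<open>realizable_glue\<close>). Their difference \<open>w\<close> vanishes at \<open>h\<close> and is dominated by
  \<open>p z * \<bar>z - h\<bar>\<close> with a polynomial \<open>p\<close>, so it can be cut off on one side of \<open>h\<close> by
  maximum and minimum with polynomials. A continuous piecewise rational function is obtained
  from its pieces by such gluings.
\<close>

section \<open>Mixed strategies, security levels and saddle points\<close>

definition pure_strategy :: "'s \<Rightarrow> 's \<Rightarrow> real" where
  "pure_strategy s t = (if t = s then 1 else 0)"

definition security_levels :: "'a set \<Rightarrow> 'b set \<Rightarrow> ('a \<Rightarrow> 'b \<Rightarrow> real) \<Rightarrow> real set" where
  "security_levels A B M = {v. \<exists>x\<in>mixed_strategies A. \<forall>b\<in>B. v \<le> (\<Sum>a\<in>A. x a * M a b)}"

definition maxmin_value :: "'a set \<Rightarrow> 'b set \<Rightarrow> ('a \<Rightarrow> 'b \<Rightarrow> real) \<Rightarrow> real \<Rightarrow> bool" where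
  "maxmin_value A B M v \<longleftrightarrow>
     v \<in> security_levels A B M \<and> (\<forall>w\<in>security_levels A B M. w \<le> v)"

definition saddle_value :: "'a set \<Rightarrow> 'b set \<Rightarrow> ('a \<Rightarrow> 'b \<Rightarrow> real) \<Rightarrow> real \<Rightarrow> bool" where
  "saddle_value A B M v \<longleftrightarrow>
     (\<exists>x\<in>mixed_strategies A. \<exists>y\<in>mixed_strategies B.
        (\<forall>b\<in>B. v \<le> (\<Sum>a\<in>A. x a * M a b)) \<and> (\<forall>a\<in>A. (\<Sum>b\<in>B. y b * M a b) \<le> v))"

lemma pure_strategy_mixed:
  assumes "finite S" "s \<in> S"
  shows "pure_strategy s \<in> mixed_strategies S"
  using assms by (auto simp: mixed_strategies_def pure_strategy_def)

lemma sum_pure_strategy: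
  assumes "finite S" "s \<in> S"
  shows "(\<Sum>t\<in>S. pure_strategy s t * f t) = f s"
proof -
  have "(\<Sum>t\<in>S. pure_strategy s t * f t) = (\<Sum>t\<in>S. if t = s then f t else 0)"
    by (intro sum.cong) (auto simp: pure_strategy_def)
  then show ?thesis using assms by simp
qed

lemma mixed_average_ge:
  assumes "y \<in> mixed_strategies B" "\<And>b. b \<in> B \<Longrightarrow> v \<le> f b"
  shows "v \<le> (\<Sum>b\<in>B. y b * f b)"
proof -
  have "v = (\<Sum>b\<in>B. y b * v)"
    using assms(1) by (simp add: mixed_strategies_def flip: sum_distrib_right)
  also have "\<dots> \<le> (\<Sum>b\<in>B. y b * f b)"
    using assms by (intro sum_mono mult_left_mono) (auto simp: mixed_strategies_def)
  finally show ?thesis .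
qed

lemma mixed_average_le:
  assumes "y \<in> mixed_strategies B" "\<And>b. b \<in> B \<Longrightarrow> f b \<le> v"
  shows "(\<Sum>b\<in>B. y b * f b) \<le> v"
  using mixed_average_ge[OF assms(1), of "- v" "\<lambda>b. - f b"] assms(2) by (simp add: sum_negf)

lemma mixed_sum_swap:
  fixes M :: "'a \<Rightarrow> 'b \<Rightarrow> real"
  shows "(\<Sum>a\<in>A. x a * (\<Sum>b\<in>B. y b * M a b)) = (\<Sum>b\<in>B. y b * (\<Sum>a\<in>A. x a * M a b))"
  by (simp add: sum_distrib_left mult.left_commute) (rule sum.swap)

text \<open>
  Player 2 has no need to mix against a known mixed strategy, so the inner infimum of the value
  is the largest level that \<open>x\<close> secures against every pure strategy.
\<close>

lemma val_eq_maxmin_value: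
  assumes fin: "finite_game \<Gamma>"
    and v: "maxmin_value (strategies1 \<Gamma>) (strategies2 \<Gamma>) (payoff \<Gamma>) v"
  shows "val \<Gamma> = v"
proof -
  define A where "A = strategies1 \<Gamma>"
  define B where "B = strategies2 \<Gamma>"
  define M where "M = payoff \<Gamma>"
  define g where "g x b = (\<Sum>a\<in>A. x a * M a b)" for x :: "'a \<Rightarrow> real" and b
  define \<phi> where "\<phi> x = (INF y\<in>mixed_strategies B. expected_payoff \<Gamma> x y)" for x
  have B: "finite B" "B \<noteq> {}"
    using fin by (auto simp: finite_game_def B_def)
  then obtain b0 where b0: "b0 \<in> B" by blast
  have ne: "mixed_strategies B \<noteq> {}"
    using pure_strategy_mixed[OF B(1) b0] by blast
  have E: "expected_payoff \<Gamma> x y = (\<Sum>b\<in>B. y b * g x b)" for x y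
    unfolding g_def using mixed_sum_swap[where x = x and A = A and y = y and B = B and M = M]
    by (simp add: expected_payoff_def A_def B_def M_def sum_distrib_left mult.assoc)
  have ge: "w \<le> \<phi> x" if "\<forall>b\<in>B. w \<le> g x b" for w x
    unfolding \<phi>_def E using that by (intro cINF_greatest[OF ne] mixed_average_ge) auto
  have le: "\<phi> x \<le> g x b" if b: "b \<in> B" for x b
  proof -
    have "bdd_below ((\<lambda>y. \<Sum>b\<in>B. y b * g x b) ` mixed_strategies B)"
      using B by (intro bdd_belowI2[where m = "Min (g x ` B)"] mixed_average_ge) auto
    then have "\<phi> x \<le> (\<Sum>b'\<in>B. pure_strategy b b' * g x b')"
      unfolding \<phi>_def E using pure_strategy_mixed[OF B(1) b] by (intro cINF_lower)
    then show ?thesis using sum_pure_strategy[OF B(1) b] by simp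
  qed
  have level: "\<phi> x \<le> v" if "x \<in> mixed_strategies A" for x
  proof -
    have "\<phi> x \<in> security_levels A B M"
      unfolding security_levels_def using that le by (auto simp: g_def)
    then show ?thesis using v by (auto simp: maxmin_value_def A_def B_def M_def)
  qed
  obtain x where x: "x \<in> mixed_strategies A" "\<forall>b\<in>B. v \<le> g x b"
    using v unfolding maxmin_value_def security_levels_def A_def B_def M_def g_def by blast
  have "\<phi> x = v" using level[OF x(1)] ge[OF x(2)] by simp
  then have "(SUP x\<in>mixed_strategies A. \<phi> x) = v"
    using x(1) level by (intro cSup_eq_maximum) auto
  then show ?thesis unfolding val_def \<phi>_def A_def B_def .
qed

lemma saddle_value_imp_maxmin_value:
  assumes "saddle_value A B M v"
  shows "maxmin_value A B M v"
proof -
  obtain x y where x: "x \<in> mixed_strategies A" "\<forall>b\<in>B. v \<le> (\<Sum>a\<in>A. x a * M a b)"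
    and y: "y \<in> mixed_strategies B" "\<forall>a\<in>A. (\<Sum>b\<in>B. y b * M a b) \<le> v"
    using assms unfolding saddle_value_def by blast
  have "w \<le> v" if "x' \<in> mixed_strategies A" "\<forall>b\<in>B. w \<le> (\<Sum>a\<in>A. x' a * M a b)" for w x'
  proof -
    have "w \<le> (\<Sum>b\<in>B. y b * (\<Sum>a\<in>A. x' a * M a b))"
      using that by (intro mixed_average_ge[OF y(1)]) auto
    also have "\<dots> = (\<Sum>a\<in>A. x' a * (\<Sum>b\<in>B. y b * M a b))"
      by (rule mixed_sum_swap[symmetric])
    also have "\<dots> \<le> v"
      using y by (intro mixed_average_le[OF that(1)]) auto
    finally show ?thesis .
  qed
  then show ?thesis using x unfolding maxmin_value_def security_levels_def by blast
qed

text \<open>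
  A strategy that secures \<open>v\<close> still secures \<open>v - \<epsilon>\<close> after each payoff has moved by at most
  \<open>\<epsilon>\<close>.
\<close>

lemma maxmin_value_lipschitz:
  assumes "maxmin_value A B M v" "maxmin_value A B M' v'"
    and close: "\<And>a b. a \<in> A \<Longrightarrow> b \<in> B \<Longrightarrow> \<bar>M a b - M' a b\<bar> \<le> \<epsilon>"
  shows "\<bar>v - v'\<bar> \<le> \<epsilon>"
proof -
  have *: "v - \<epsilon> \<le> v'" if v: "maxmin_value A B M v" "maxmin_value A B M' v'"
    and close: "\<And>a b. a \<in> A \<Longrightarrow> b \<in> B \<Longrightarrow> \<bar>M a b - M' a b\<bar> \<le> \<epsilon>" for M M' v v'
  proof -
    obtain x where x: "x \<in> mixed_strategies A" "\<forall>b\<in>B. v \<le> (\<Sum>a\<in>A. x a * M a b)"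
      using v(1) unfolding maxmin_value_def security_levels_def by blast
    have "v - \<epsilon> \<le> (\<Sum>a\<in>A. x a * M' a b)" if b: "b \<in> B" for b
    proof -
      have "(\<Sum>a\<in>A. x a * (M a b - M' a b)) \<le> \<epsilon>"
        using x(1) close[OF _ b] by (intro mixed_average_le) (auto simp: abs_le_iff)
      then show ?thesis using x(2) b by (force simp: right_diff_distrib sum_subtractf)
    qed
    then have "v - \<epsilon> \<in> security_levels A B M'"
      using x(1) unfolding security_levels_def by blast
    then show ?thesis using v(2) unfolding maxmin_value_def by blast
  qed
  show ?thesis
    using *[OF assms] *[OF assms(2,1)] close by (force simp: abs_minus_commute)
qed

text \<open>
  Each difference \<open>G z - G h\<close> of payoffs has the factor \<open>z - h\<close>, and the largest of the finitely
  many other factors has a polynomial bound. That the bound is a polynomial is essential for gluing,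
  where \<open>p z * (z - h)\<close> becomes a payoff.
\<close>

lemma polynomial_value_lipschitz_at:
  fixes G :: "'a \<Rightarrow> 'b \<Rightarrow> real poly"
  assumes fin: "finite A" "finite B"
    and f: "\<And>z. maxmin_value A B (\<lambda>a b. poly (G a b) z) (f z)"
  shows "\<exists>p. \<forall>z. \<bar>f z - f h\<bar> \<le> poly p z * \<bar>z - h\<bar>"
proof -
  define q where "q a b = (G a b - [:poly (G a b) h:]) div [:- h, 1:]" for a b
  have q: "poly (G a b) z - poly (G a b) h = (z - h) * poly (q a b) z" for a b z
  proof -
    have "[:- h, 1:] dvd G a b - [:poly (G a b) h:]"
      by (simp add: poly_eq_0_iff_dvd[symmetric])
    then have "G a b - [:poly (G a b) h:] = [:- h, 1:] * q a b"
      unfolding q_def by (metis dvd_mult_div_cancel)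
    then have "poly (G a b - [:poly (G a b) h:]) z = poly ([:- h, 1:] * q a b) z" by simp
    then show ?thesis by (simp add: algebra_simps)
  qed
  \<comment> \<open>\<open>1 + t\<^sup>2\<close> is a polynomial bound for \<open>\<bar>t\<bar>\<close>.\<close>
  define p where "p = (\<Sum>a\<in>A. \<Sum>b\<in>B. 1 + (q a b)\<^sup>2)"
  have abs_le: "\<bar>t\<bar> \<le> 1 + t\<^sup>2" for t :: real
  proof -
    have "0 \<le> (\<bar>t\<bar> - 1)\<^sup>2" by simp
    then show ?thesis by (simp add: power2_diff)
  qed
  have "\<bar>f z - f h\<bar> \<le> poly p z * \<bar>z - h\<bar>" for z
  proof (rule maxmin_value_lipschitz[OF f f])
    fix a b assume ab: "a \<in> A" "b \<in> B"
    have "\<bar>poly (q a b) z\<bar> \<le> 1 + (poly (q a b) z)\<^sup>2" by (rule abs_le)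
    also have "\<dots> \<le> (\<Sum>b\<in>B. 1 + (poly (q a b) z)\<^sup>2)"
      by (rule member_le_sum) (use ab fin in auto)
    also have "\<dots> \<le> (\<Sum>a\<in>A. \<Sum>b\<in>B. 1 + (poly (q a b) z)\<^sup>2)"
      by (rule member_le_sum[where f = "\<lambda>a. \<Sum>b\<in>B. 1 + (poly (q a b) z)\<^sup>2"])
        (use ab fin in \<open>auto intro: sum_nonneg\<close>)
    also have "\<dots> = poly p z" by (simp add: p_def poly_sum)
    finally have "\<bar>poly (q a b) z\<bar> * \<bar>z - h\<bar> \<le> poly p z * \<bar>z - h\<bar>"
      by (rule mult_right_mono) simp
    then show "\<bar>poly (G a b) z - poly (G a b) h\<bar> \<le> poly p z * \<bar>z - h\<bar>"
      by (simp add: q abs_mult mult.commute)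
  qed
  then show ?thesis by blast
qed

lemma polynomial_value_continuous:
  fixes G :: "'a \<Rightarrow> 'b \<Rightarrow> real poly"
  assumes "finite A" "finite B"
    and "\<And>z. maxmin_value A B (\<lambda>a b. poly (G a b) z) (f z)"
  shows "continuous_on UNIV f"
proof -
  have "isCont f h" for h
  proof -
    obtain p where p: "\<And>z. \<bar>f z - f h\<bar> \<le> poly p z * \<bar>z - h\<bar>"
      using polynomial_value_lipschitz_at[OF assms] by blast
    have "((\<lambda>z. poly p z * \<bar>z - h\<bar>) \<longlongrightarrow> poly p h * \<bar>h - h\<bar>) (at h)"
      by (intro tendsto_intros)
    then have "((\<lambda>z. poly p z * \<bar>z - h\<bar>) \<longlongrightarrow> 0) (at h)" by simp
    then have "((\<lambda>z. f z - f h) \<longlongrightarrow> 0) (at h)"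
      by (rule Lim_null_comparison[rotated]) (use p in simp_all)
    then show ?thesis
      by (simp add: isCont_def LIM_zero_cancel)
  qed
  then show ?thesis by (simp add: continuous_at_imp_continuous_on)
qed

section \<open>Functions with values in finitely many rational functions\<close>

text \<open>
  The selection among the quotients may depend on \<open>z\<close> in any way. This makes the class closed
  under field operations and under arbitrary pointwise case distinctions, so that it can serve
  as the coefficient domain of an elimination procedure that branches on signs.
\<close>

definition finitely_rational :: "(real \<Rightarrow> real) \<Rightarrow> bool" where
  "finitely_rational f \<longleftrightarrow>
     (\<exists>F :: (real poly \<times> real poly) set. finite F \<and>
        (\<forall>z. \<exists>(P, Q)\<in>F. poly Q z \<noteq> 0 \<and> f z = poly P z / poly Q z))"

lemma finitely_rational_poly: "finitely_rational (poly p)"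
  unfolding finitely_rational_def by (rule exI[of _ "{(p, 1)}"]) auto

lemma finitely_rational_const: "finitely_rational (\<lambda>_. c)"
proof -
  have "poly [:c:] = (\<lambda>_. c)" by auto
  then show ?thesis using finitely_rational_poly[of "[:c:]"] by simp
qed

lemma finitely_rational_binary:
  assumes f: "finitely_rational f" and g: "finitely_rational g"
    and op: "\<And>z P Q P' Q'. \<lbrakk>poly Q z \<noteq> 0; f z = poly P z / poly Q z;
                poly Q' z \<noteq> 0; g z = poly P' z / poly Q' z\<rbrakk>
              \<Longrightarrow> \<exists>(N, D)\<in>op P Q P' Q'. poly D z \<noteq> 0 \<and> h z = poly N z / poly D z"
    and fin: "\<And>P Q P' Q'. finite (op P Q P' Q')"
  shows "finitely_rational h"
proof -
  obtain F where F: "finite F" "\<And>z. \<exists>(P, Q)\<in>F. poly Q z \<noteq> 0 \<and> f z = poly P z / poly Q z"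
    using f unfolding finitely_rational_def by blast
  obtain H where H: "finite H" "\<And>z. \<exists>(P, Q)\<in>H. poly Q z \<noteq> 0 \<and> g z = poly P z / poly Q z"
    using g unfolding finitely_rational_def by blast
  define R where "R = (\<Union>(P, Q)\<in>F. \<Union>(P', Q')\<in>H. op P Q P' Q')"
  have "finite R" unfolding R_def using F(1) H(1) fin by auto
  moreover have "\<exists>(N, D)\<in>R. poly D z \<noteq> 0 \<and> h z = poly N z / poly D z" for z
  proof -
    obtain P Q where PQ: "(P, Q) \<in> F" "poly Q z \<noteq> 0" "f z = poly P z / poly Q z"
      using F(2)[of z] by blast
    obtain P' Q' where PQ': "(P', Q') \<in> H" "poly Q' z \<noteq> 0" "g z = poly P' z / poly Q' z"
      using H(2)[of z] by blast
    obtain N D where "(N, D) \<in> op P Q P' Q'" "poly D z \<noteq> 0" "h z = poly N z / poly D z"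
      using op[OF PQ(2,3) PQ'(2,3)] by blast
    then show ?thesis unfolding R_def using PQ(1) PQ'(1) by blast
  qed
  ultimately show ?thesis unfolding finitely_rational_def by blast
qed

lemma finitely_rational_diff:
  assumes "finitely_rational f" "finitely_rational g"
  shows "finitely_rational (\<lambda>z. f z - g z)"
  by (rule finitely_rational_binary[OF assms, where op = "\<lambda>P Q P' Q'. {(P * Q' - P' * Q, Q * Q')}"])
    (auto simp: diff_frac_eq)

lemma finitely_rational_mult:
  assumes "finitely_rational f" "finitely_rational g"
  shows "finitely_rational (\<lambda>z. f z * g z)"
  by (rule finitely_rational_binary[OF assms, where op = "\<lambda>P Q P' Q'. {(P * P', Q * Q')}"])
    auto

text \<open>The pair \<open>(0, 1)\<close> accounts for the convention \<open>x / 0 = 0\<close>.\<close>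

lemma finitely_rational_divide:
  assumes "finitely_rational f" "finitely_rational g"
  shows "finitely_rational (\<lambda>z. f z / g z)"
proof (rule finitely_rational_binary[OF assms, where op = "\<lambda>P Q P' Q'. {(P * Q', Q * P'), (0, 1)}"])
  fix z P Q P' Q'
  assume "poly Q z \<noteq> 0" "f z = poly P z / poly Q z" "poly Q' z \<noteq> 0" "g z = poly P' z / poly Q' z"
  then show "\<exists>(N, D)\<in>{(P * Q', Q * P'), (0, 1)}. poly D z \<noteq> 0 \<and> f z / g z = poly N z / poly D z"
    by (cases "poly P' z = 0") auto
qed auto

lemma finitely_rational_choice:
  assumes fin: "finite S" and S: "\<And>g. g \<in> S \<Longrightarrow> finitely_rational g"
    and ex: "\<And>z. \<exists>g\<in>S. f z = g z"
  shows "finitely_rational f"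
proof -
  have "\<forall>g\<in>S. \<exists>F. finite F \<and> (\<forall>z. \<exists>(P, Q)\<in>F. poly Q z \<noteq> 0 \<and> g z = poly P z / poly Q z)"
    using S unfolding finitely_rational_def by blast
  from bchoice[OF this] obtain F where F: "\<And>g. g \<in> S \<Longrightarrow> finite (F g)"
    "\<And>g z. g \<in> S \<Longrightarrow> \<exists>(P, Q)\<in>F g. poly Q z \<noteq> 0 \<and> g z = poly P z / poly Q z"
    by blast
  have "\<exists>(P, Q)\<in>\<Union>(F ` S). poly Q z \<noteq> 0 \<and> f z = poly P z / poly Q z" for z
  proof -
    obtain g where "g \<in> S" "f z = g z" using ex by blast
    then show ?thesis using F(2)[of g z] by auto
  qed
  moreover have "finite (\<Union>(F ` S))" using fin F(1) by blast
  ultimately show ?thesis unfolding finitely_rational_def by blast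
qed

section \<open>Fourier--Motzkin elimination with parameters\<close>

text \<open>
  A constraint is a family of coefficients, indexed by the unknowns, that depend on the
  parameter. Constraints are homogeneous; a constant term is the coefficient of an unknown that
  is set to \<open>1\<close>.
\<close>

definition feasible :: "'v set \<Rightarrow> ('v \<Rightarrow> real \<Rightarrow> real) set \<Rightarrow> real \<Rightarrow> ('v \<Rightarrow> real) \<Rightarrow> bool" where
  "feasible V C z x \<longleftrightarrow> (\<forall>c\<in>C. 0 \<le> (\<Sum>j\<in>V. c j z * x j))"

definition rational_system :: "('v \<Rightarrow> real \<Rightarrow> real) set \<Rightarrow> bool" where
  "rational_system C \<longleftrightarrow> finite C \<and> (\<forall>c\<in>C. \<forall>j. finitely_rational (c j))"

lemma feasible_cong:
  assumes "\<And>j. j \<in> V \<Longrightarrow> x j = y j"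
  shows "feasible V C z x \<longleftrightarrow> feasible V C z y"
  unfolding feasible_def using assms by simp

lemma between_finite_sets:
  fixes L U :: "real set"
  assumes "finite L" "finite U" "\<And>l u. l \<in> L \<Longrightarrow> u \<in> U \<Longrightarrow> l \<le> u"
  shows "\<exists>t. (\<forall>l\<in>L. l \<le> t) \<and> (\<forall>u\<in>U. t \<le> u)"
proof (cases "L = {}")
  case True
  then show ?thesis
    using assms(2) by (cases "U = {}") (auto intro!: exI[of _ "Min U"])
next
  case False
  then show ?thesis
    using assms by (intro exI[of _ "Max L"]) auto
qed

definition eliminate_pair ::
    "'v \<Rightarrow> ('v \<Rightarrow> real \<Rightarrow> real) \<Rightarrow> ('v \<Rightarrow> real \<Rightarrow> real) \<Rightarrow> 'v \<Rightarrow> real \<Rightarrow> real" where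
  "eliminate_pair v c d j z =
     (if 0 < c v z \<and> d v z < 0 then c v z * d j z - d v z * c j z
      else if c v z = 0 then c j z else 0)"

lemma finitely_rational_eliminate_pair:
  assumes "\<And>j. finitely_rational (c j)" "\<And>j. finitely_rational (d j)"
  shows "finitely_rational (eliminate_pair v c d j)"
proof (rule finitely_rational_choice[where
      S = "{\<lambda>z. c v z * d j z - d v z * c j z, c j, \<lambda>_. 0}"])
  fix g assume "g \<in> {\<lambda>z. c v z * d j z - d v z * c j z, c j, \<lambda>_. 0}"
  then show "finitely_rational g"
    using assms finitely_rational_const
    by (auto intro!: finitely_rational_diff finitely_rational_mult)
qed (auto simp: eliminate_pair_def)

text \<open>
  A constraint with a positive coefficient of \<open>v\<close> bounds \<open>v\<close> from below, one with a negative
  coefficient bounds it from above, and a value of \<open>v\<close> exists if and only if each lower bound is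
  at most each upper bound. As the signs depend on the parameter, the new system contains a
  constraint for each pair \<open>(c, d)\<close>. Where \<open>c\<close> and \<open>d\<close> are not a lower and an upper
  bound, it reduces to \<open>c\<close> if \<open>v\<close> is absent from \<open>c\<close>, and to \<open>0 \<le> 0\<close> otherwise.
\<close>

lemma eliminate_unknown:
  fixes C :: "('v \<Rightarrow> real \<Rightarrow> real) set"
  assumes fin: "finite V" and v: "v \<notin> V" and C: "rational_system C"
  shows "\<exists>C'. rational_system C' \<and>
           (\<forall>z x. feasible V C' z x \<longleftrightarrow> (\<exists>t. feasible (insert v V) C z (x(v := t))))"
proof -
  define C' where "C' = (\<lambda>(c, d). eliminate_pair v c d) ` (C \<times> C)"
  have finC: "finite C" using C by (simp add: rational_system_def)
  have "rational_system C'"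
    using C
    by (auto simp: rational_system_def C'_def intro!: finitely_rational_eliminate_pair)
  moreover have "feasible V C' z x \<longleftrightarrow> (\<exists>t. feasible (insert v V) C z (x(v := t)))" for z x
  proof -
    define L where "L c = (\<Sum>j\<in>V. c j z * x j)" for c :: "'v \<Rightarrow> real \<Rightarrow> real"
    have full: "(\<Sum>j\<in>insert v V. c j z * (x(v := t)) j) = c v z * t + L c" for c t
    proof -
      have "(\<Sum>j\<in>V. c j z * (x(v := t)) j) = L c"
        unfolding L_def using v by (intro sum.cong) auto
      then show ?thesis using fin v by simp
    qed
    have pair: "(\<Sum>j\<in>V. eliminate_pair v c d j z * x j) =
        (if 0 < c v z \<and> d v z < 0 then c v z * L d - d v z * L c
         else if c v z = 0 then L c else 0)" for c d
      by (auto simp: eliminate_pair_def L_def left_diff_distrib sum_subtractf sum_distrib_left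
          mult.assoc)
    show ?thesis
    proof
      assume feas: "feasible V C' z x"
      then have ge: "0 \<le> (\<Sum>j\<in>V. eliminate_pair v c d j z * x j)" if "c \<in> C" "d \<in> C" for c d
        using that by (force simp: feasible_def C'_def)
      have zero: "0 \<le> L c" if "c \<in> C" "c v z = 0" for c
        using ge[OF that(1,1)] that(2) by (simp add: pair)
      have cross: "0 \<le> c v z * L d - d v z * L c"
        if "c \<in> C" "d \<in> C" "0 < c v z" "d v z < 0" for c d
        using ge[OF that(1,2)] that(3,4) by (simp add: pair)
      define lower where "lower = (\<lambda>c. - L c / c v z) ` {c\<in>C. 0 < c v z}"
      define upper where "upper = (\<lambda>c. - L c / c v z) ` {c\<in>C. c v z < 0}"
      have "\<exists>t. (\<forall>l\<in>lower. l \<le> t) \<and> (\<forall>u\<in>upper. t \<le> u)"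
      proof (rule between_finite_sets)
        fix l u assume "l \<in> lower" "u \<in> upper"
        then obtain c d where "c \<in> C" "0 < c v z" "l = - L c / c v z"
          "d \<in> C" "d v z < 0" "u = - L d / d v z"
          unfolding lower_def upper_def by blast
        then have cd: "0 < c v z" "d v z < 0" "l * c v z = - L c" "u * d v z = - L d"
          "0 \<le> c v z * L d - d v z * L c"
          using cross[of c d] by auto
        have "(u - l) * (c v z * (- d v z)) = c v z * (- (u * d v z)) + d v z * (l * c v z)"
          by (simp add: algebra_simps)
        then have "0 \<le> (u - l) * (c v z * (- d v z))" using cd by simp
        moreover have "0 < c v z * (- d v z)" using cd by (intro mult_pos_pos) auto
        ultimately show "l \<le> u" by (simp only: zero_le_mult_iff) auto
      qed (use finC in \<open>auto simp: lower_def upper_def\<close>)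
      then obtain t where t: "\<forall>l\<in>lower. l \<le> t" "\<forall>u\<in>upper. t \<le> u" by blast
      have "0 \<le> c v z * t + L c" if c: "c \<in> C" for c
      proof (rule linorder_cases[of "c v z" 0])
        assume "c v z < 0"
        then have "t \<le> - L c / c v z" using t c unfolding upper_def by blast
        then show ?thesis using \<open>c v z < 0\<close>
          by (simp add: neg_le_divide_eq mult.commute del: divide_minus_left)
      next
        assume "c v z = 0"
        then show ?thesis using zero[OF c] by simp
      next
        assume "0 < c v z"
        then have "- L c / c v z \<le> t" using t c unfolding lower_def by blast
        then show ?thesis using \<open>0 < c v z\<close>
          by (simp add: pos_divide_le_eq mult.commute del: divide_minus_left)
      qed
      then show "\<exists>t. feasible (insert v V) C z (x(v := t))"
        unfolding feasible_def full by blast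
    next
      assume "\<exists>t. feasible (insert v V) C z (x(v := t))"
      then obtain t where t: "\<And>c. c \<in> C \<Longrightarrow> 0 \<le> c v z * t + L c"
        unfolding feasible_def full by blast
      have "0 \<le> (\<Sum>j\<in>V. eliminate_pair v c d j z * x j)" if cd: "c \<in> C" "d \<in> C" for c d
      proof (cases "0 < c v z \<and> d v z < 0")
        case True
        have "0 \<le> c v z * (d v z * t + L d)" "0 \<le> (- d v z) * (c v z * t + L c)"
          using True t[OF cd(1)] t[OF cd(2)] by (simp_all only: zero_le_mult_iff) auto
        then have "0 \<le> c v z * (d v z * t + L d) + (- d v z) * (c v z * t + L c)"
          by (rule add_nonneg_nonneg)
        also have "\<dots> = c v z * L d - d v z * L c" by (simp add: algebra_simps)
        finally show ?thesis using True by (simp add: pair)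
      next
        case False
        then show ?thesis using t[OF cd(1)] by (auto simp: pair)
      qed
      then show "feasible V C' z x" by (auto simp: feasible_def C'_def)
    qed
  qed
  ultimately show ?thesis by blast
qed

lemma eliminate_unknowns:
  assumes "finite S" "finite V" "S \<inter> V = {}" "rational_system C"
  shows "\<exists>C'. rational_system C' \<and>
           (\<forall>z x. feasible V C' z x \<longleftrightarrow> (\<exists>y. (\<forall>j\<in>V. y j = x j) \<and> feasible (V \<union> S) C z y))"
  using assms
proof (induction S arbitrary: C rule: finite_induct)
  case empty
  have "feasible V C z x \<longleftrightarrow> (\<exists>y. (\<forall>j\<in>V. y j = x j) \<and> feasible V C z y)" for z x
  proof
    assume "\<exists>y. (\<forall>j\<in>V. y j = x j) \<and> feasible V C z y"
    then obtain y where y: "\<forall>j\<in>V. y j = x j" "feasible V C z y" by blast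
    have "feasible V C z y \<longleftrightarrow> feasible V C z x" by (rule feasible_cong) (use y(1) in blast)
    then show "feasible V C z x" using y(2) by blast
  next
    assume "feasible V C z x"
    then show "\<exists>y. (\<forall>j\<in>V. y j = x j) \<and> feasible V C z y" by blast
  qed
  then show ?case unfolding Un_empty_right using empty.prems(3) by blast
next
  case (insert v S)
  obtain C1 where C1: "rational_system C1"
    "\<And>z x. feasible (V \<union> S) C1 z x \<longleftrightarrow> (\<exists>t. feasible (insert v (V \<union> S)) C z (x(v := t)))"
    using eliminate_unknown[OF _ _ insert.prems(3), of "V \<union> S" v] insert.hyps insert.prems
    by blast
  obtain C2 where C2: "rational_system C2"
    "\<And>z x. feasible V C2 z x \<longleftrightarrow> (\<exists>y. (\<forall>j\<in>V. y j = x j) \<and> feasible (V \<union> S) C1 z y)"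
    using insert.IH[OF insert.prems(1) _ C1(1)] insert.prems(2) by blast
  have "feasible V C2 z x \<longleftrightarrow> (\<exists>y. (\<forall>j\<in>V. y j = x j) \<and> feasible (V \<union> insert v S) C z y)"
    for z x
  proof -
    have "v \<notin> V" using insert.prems by blast
    have "(\<exists>y. (\<forall>j\<in>V. y j = x j) \<and> feasible (V \<union> S) C1 z y) \<longleftrightarrow>
          (\<exists>y t. (\<forall>j\<in>V. y j = x j) \<and> feasible (V \<union> insert v S) C z (y(v := t)))"
      unfolding C1(2) by simp
    also have "\<dots> \<longleftrightarrow> (\<exists>y. (\<forall>j\<in>V. y j = x j) \<and> feasible (V \<union> insert v S) C z y)"
    proof
      assume "\<exists>y t. (\<forall>j\<in>V. y j = x j) \<and> feasible (V \<union> insert v S) C z (y(v := t))"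
      then obtain y t where "\<forall>j\<in>V. y j = x j" "feasible (V \<union> insert v S) C z (y(v := t))"
        by blast
      then show "\<exists>y. (\<forall>j\<in>V. y j = x j) \<and> feasible (V \<union> insert v S) C z y"
        using \<open>v \<notin> V\<close> by (intro exI[of _ "y(v := t)"]) auto
    next
      assume "\<exists>y. (\<forall>j\<in>V. y j = x j) \<and> feasible (V \<union> insert v S) C z y"
      then show "\<exists>y t. (\<forall>j\<in>V. y j = x j) \<and> feasible (V \<union> insert v S) C z (y(v := t))"
        by (metis fun_upd_triv)
    qed
    finally show ?thesis using C2(2) by simp
  qed
  then show ?case using C2(1) by blast
qed

section \<open>The value as a selection of rational functions\<close>

text \<open>
  The unknowns of the linear program for the maximal security level; \<open>Unit\<close> is the unknown that
  is set to \<open>1\<close>.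
\<close>

datatype 'a unknown = Unit | Level | Weight 'a

definition payoff_constraint :: "('a \<Rightarrow> 'b \<Rightarrow> real poly) \<Rightarrow> 'b \<Rightarrow> 'a unknown \<Rightarrow> real \<Rightarrow> real" where
  "payoff_constraint G b j =
     (case j of Unit \<Rightarrow> (\<lambda>_. 0) | Level \<Rightarrow> (\<lambda>_. - 1) | Weight a \<Rightarrow> poly (G a b))"

definition nonneg_constraint :: "'a \<Rightarrow> 'a unknown \<Rightarrow> real \<Rightarrow> real" where
  "nonneg_constraint a j = (\<lambda>_. if j = Weight a then 1 else 0)"

text \<open>
  The signs \<open>s = 1\<close> and \<open>s = - 1\<close> give the two inequalities that make the weights sum to \<open>1\<close>.
\<close>

definition total_constraint :: "real \<Rightarrow> 'a unknown \<Rightarrow> real \<Rightarrow> real" where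
  "total_constraint s j = (\<lambda>_. case j of Unit \<Rightarrow> - s | Level \<Rightarrow> 0 | Weight a \<Rightarrow> s)"

text \<open>
  The levels that Player 1 can secure are the projection of a polyhedron to one coordinate, so
  elimination of the weights leaves finitely many linear inequalities for the level.
\<close>

lemma security_levels_constraints:
  fixes G :: "'a \<Rightarrow> 'b \<Rightarrow> real poly"
  assumes fin: "finite A" "finite B"
  shows "\<exists>C :: ('a unknown \<Rightarrow> real \<Rightarrow> real) set. rational_system C \<and>
           (\<forall>z. security_levels A B (\<lambda>a b. poly (G a b) z) =
                 {v. \<forall>c\<in>C. 0 \<le> c Unit z + c Level z * v})"
proof -
  define C where "C = payoff_constraint G ` B \<union> nonneg_constraint ` A \<union> total_constraint ` {1, - 1}"
  define V :: "'a unknown set" where "V = {Unit, Level}"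
  have "rational_system C"
    unfolding rational_system_def C_def
    using fin finitely_rational_const finitely_rational_poly
    by (auto simp: payoff_constraint_def nonneg_constraint_def total_constraint_def
        split: unknown.split)
  then obtain C' where C': "rational_system C'"
    "\<And>z x. feasible V C' z x \<longleftrightarrow>
       (\<exists>y. (\<forall>j\<in>V. y j = x j) \<and> feasible (V \<union> Weight ` A) C z y)"
    using eliminate_unknowns[of "Weight ` A" V C] fin by (auto simp: V_def)
  have "v \<in> security_levels A B (\<lambda>a b. poly (G a b) z) \<longleftrightarrow> (\<forall>c\<in>C'. 0 \<le> c Unit z + c Level z * v)"
    for z v
  proof -
    define x :: "'a unknown \<Rightarrow> real" where
      "x j = (case j of Unit \<Rightarrow> 1 | Level \<Rightarrow> v | Weight a \<Rightarrow> 0)" for j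
    have sum: "(\<Sum>j\<in>V \<union> Weight ` A. c j z * y j) =
        c Unit z * y Unit + c Level z * y Level + (\<Sum>a\<in>A. c (Weight a) z * y (Weight a))"
      for c y
    proof -
      have "(\<Sum>j\<in>V \<union> Weight ` A. c j z * y j) =
          (\<Sum>j\<in>V. c j z * y j) + (\<Sum>j\<in>Weight ` A. c j z * y j)"
        using fin by (intro sum.union_disjoint) (auto simp: V_def)
      also have "(\<Sum>j\<in>Weight ` A. c j z * y j) = (\<Sum>a\<in>A. c (Weight a) z * y (Weight a))"
        by (subst sum.reindex) (auto simp: inj_on_def)
      finally show ?thesis by (simp add: V_def)
    qed
    have "feasible V C' z x \<longleftrightarrow> (\<forall>c\<in>C'. 0 \<le> c Unit z + c Level z * v)"
      by (simp add: feasible_def V_def x_def)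
    moreover have "(\<exists>y. (\<forall>j\<in>V. y j = x j) \<and> feasible (V \<union> Weight ` A) C z y) \<longleftrightarrow>
        v \<in> security_levels A B (\<lambda>a b. poly (G a b) z)"
    proof
      assume "\<exists>y. (\<forall>j\<in>V. y j = x j) \<and> feasible (V \<union> Weight ` A) C z y"
      then obtain y where y: "y Unit = 1" "y Level = v" "feasible (V \<union> Weight ` A) C z y"
        by (auto simp: V_def x_def)
      define w where "w a = (if a \<in> A then y (Weight a) else 0)" for a
      have cons: "0 \<le> c Unit z + c Level z * v + (\<Sum>a\<in>A. c (Weight a) z * w a)"
        if "c \<in> C" for c
        using y that by (simp add: feasible_def sum w_def cong: sum.cong)
      have "0 \<le> w a" if "a \<in> A" for a
      proof -
        have "(\<Sum>a'\<in>A. nonneg_constraint a (Weight a') z * w a') =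
            (\<Sum>a'\<in>A. if a' = a then w a' else 0)"
          by (intro sum.cong) (auto simp: nonneg_constraint_def)
        then show ?thesis
          using cons[of "nonneg_constraint a"] that fin
          by (simp add: C_def) (simp add: nonneg_constraint_def)
      qed
      moreover have "(\<Sum>a\<in>A. w a) = 1"
        using cons[of "total_constraint 1"] cons[of "total_constraint (- 1)"]
        by (simp add: C_def) (simp add: total_constraint_def sum_negf)
      ultimately have "w \<in> mixed_strategies A"
        by (simp add: mixed_strategies_def w_def)
      moreover have "v \<le> (\<Sum>a\<in>A. w a * poly (G a b) z)" if "b \<in> B" for b
        using cons[of "payoff_constraint G b"] that
        by (simp add: C_def) (simp add: payoff_constraint_def mult.commute)
      ultimately show "v \<in> security_levels A B (\<lambda>a b. poly (G a b) z)"
        unfolding security_levels_def by blast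
    next
      assume "v \<in> security_levels A B (\<lambda>a b. poly (G a b) z)"
      then obtain w where w: "w \<in> mixed_strategies A"
        "\<And>b. b \<in> B \<Longrightarrow> v \<le> (\<Sum>a\<in>A. w a * poly (G a b) z)"
        unfolding security_levels_def by blast
      define y where "y j = (case j of Unit \<Rightarrow> 1 | Level \<Rightarrow> v | Weight a \<Rightarrow> w a)" for j
      have "0 \<le> c Unit z + c Level z * v + (\<Sum>a\<in>A. c (Weight a) z * w a)" if "c \<in> C" for c
        using that w unfolding C_def
        by (auto simp: payoff_constraint_def nonneg_constraint_def total_constraint_def
            mixed_strategies_def sum_negf mult.commute intro!: sum_nonneg)
      then have "feasible (V \<union> Weight ` A) C z y"
        by (simp add: feasible_def sum y_def)
      then show "\<exists>y. (\<forall>j\<in>V. y j = x j) \<and> feasible (V \<union> Weight ` A) C z y"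
        by (intro exI[of _ y]) (simp add: V_def x_def y_def)
    qed
    ultimately show ?thesis using C'(2) by simp
  qed
  then show ?thesis using C'(1) by (intro exI[of _ C']) auto
qed

text \<open>
  Only the constraints with a negative slope bound \<open>v\<close> from above. The least of their zeros is
  the maximum, because every other constraint that holds at \<open>v0\<close> holds further up as well.
\<close>

lemma linear_constraints_maximum:
  fixes \<alpha> \<beta> :: "'c \<Rightarrow> real"
  assumes fin: "finite C" and v0: "\<forall>c\<in>C. 0 \<le> \<alpha> c + \<beta> c * v0"
    and bound: "\<And>v. \<forall>c\<in>C. 0 \<le> \<alpha> c + \<beta> c * v \<Longrightarrow> v \<le> K"
  shows "\<exists>c\<in>C. (\<forall>d\<in>C. 0 \<le> \<alpha> d + \<beta> d * (- \<alpha> c / \<beta> c)) \<and>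
           (\<forall>v. (\<forall>d\<in>C. 0 \<le> \<alpha> d + \<beta> d * v) \<longrightarrow> v \<le> - \<alpha> c / \<beta> c)"
proof -
  define N where "N = {c\<in>C. \<beta> c < 0}"
  have up: "v \<le> - \<alpha> c / \<beta> c" if "0 \<le> \<alpha> c + \<beta> c * v" "\<beta> c < 0" for v c
    using that by (simp add: neg_le_divide_eq mult.commute del: divide_minus_left)
  have "N \<noteq> {}"
  proof
    assume "N = {}"
    then have "\<beta> c \<ge> 0" if "c \<in> C" for c using that by (force simp: N_def)
    then have "\<beta> c * v0 \<le> \<beta> c * (max v0 K + 1)" if "c \<in> C" for c
      using that by (intro mult_left_mono) auto
    then have "\<forall>c\<in>C. 0 \<le> \<alpha> c + \<beta> c * (max v0 K + 1)" using v0 by force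
    then show False using bound by fastforce
  qed
  moreover have "finite N" using fin by (simp add: N_def)
  ultimately obtain c where c: "c \<in> N" "\<And>d. d \<in> N \<Longrightarrow> - \<alpha> c / \<beta> c \<le> - \<alpha> d / \<beta> d"
    using ex_is_arg_min_if_finite[of N "\<lambda>c. - \<alpha> c / \<beta> c"] by (auto simp: is_arg_min_linorder)
  define m where "m = - \<alpha> c / \<beta> c"
  have "v0 \<le> m" unfolding m_def using c(1) v0 by (intro up) (auto simp: N_def)
  have "0 \<le> \<alpha> d + \<beta> d * m" if d: "d \<in> C" for d
  proof (cases "\<beta> d < 0")
    case True
    then have "m \<le> - \<alpha> d / \<beta> d" unfolding m_def using c(2) d by (simp add: N_def)
    then show ?thesis using True by (simp add: neg_le_divide_eq mult.commute del: divide_minus_left)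
  next
    case False
    then have "\<beta> d * v0 \<le> \<beta> d * m" using \<open>v0 \<le> m\<close> by (intro mult_left_mono) auto
    then show ?thesis using v0 d by force
  qed
  moreover have "\<forall>v. (\<forall>d\<in>C. 0 \<le> \<alpha> d + \<beta> d * v) \<longrightarrow> v \<le> m"
    unfolding m_def using c(1) up by (auto simp: N_def)
  ultimately show ?thesis using c(1) unfolding m_def N_def by blast
qed

lemma polynomial_value_finitely_rational:
  fixes G :: "'a \<Rightarrow> 'b \<Rightarrow> real poly"
  assumes A: "finite A" "A \<noteq> {}" and B: "finite B" "B \<noteq> {}"
  shows "\<exists>f. finitely_rational f \<and> (\<forall>z. maxmin_value A B (\<lambda>a b. poly (G a b) z) (f z))"
proof -
  obtain C :: "('a unknown \<Rightarrow> real \<Rightarrow> real) set" where C: "rational_system C"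
    "\<And>z. security_levels A B (\<lambda>a b. poly (G a b) z) = {v. \<forall>c\<in>C. 0 \<le> c Unit z + c Level z * v}"
    using security_levels_constraints[OF A(1) B(1)] by blast
  obtain a0 b0 where ab: "a0 \<in> A" "b0 \<in> B" using A B by blast
  have ex: "\<exists>c\<in>C. maxmin_value A B (\<lambda>a b. poly (G a b) z) (- c Unit z / c Level z)" for z
  proof -
    define W where "W = security_levels A B (\<lambda>a b. poly (G a b) z)"
    have W: "v \<in> W \<longleftrightarrow> (\<forall>c\<in>C. 0 \<le> c Unit z + c Level z * v)" for v
      unfolding W_def C(2) by simp
    have "Min ((\<lambda>b. poly (G a0 b) z) ` B) \<in> W"
      unfolding W_def security_levels_def
      using pure_strategy_mixed[OF A(1) ab(1)] B(1) sum_pure_strategy[OF A(1) ab(1)]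
      by (auto intro!: bexI[of _ "pure_strategy a0"])
    moreover have "v \<le> Max ((\<lambda>a. poly (G a b0) z) ` A)" if vW: "v \<in> W" for v
    proof -
      obtain x where x: "x \<in> mixed_strategies A" "v \<le> (\<Sum>a\<in>A. x a * poly (G a b0) z)"
        using vW ab(2) unfolding W_def security_levels_def by blast
      note x(2)
      also have "(\<Sum>a\<in>A. x a * poly (G a b0) z) \<le> Max ((\<lambda>a. poly (G a b0) z) ` A)"
        using A(1) by (intro mixed_average_le[OF x(1)]) auto
      finally show ?thesis .
    qed
    ultimately have "\<exists>c\<in>C. - c Unit z / c Level z \<in> W \<and> (\<forall>v\<in>W. v \<le> - c Unit z / c Level z)"
      using linear_constraints_maximum[of C "\<lambda>c. c Unit z" "\<lambda>c. c Level z"] C(1)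
      unfolding Ball_def[of W] W rational_system_def by blast
    then show ?thesis unfolding maxmin_value_def W_def .
  qed
  then obtain c where c: "\<And>z. c z \<in> C"
    "\<And>z. maxmin_value A B (\<lambda>a b. poly (G a b) z) (- c z Unit z / c z Level z)"
    by metis
  define f where "f z = - c z Unit z / c z Level z" for z
  have "finitely_rational f"
  proof (rule finitely_rational_choice[where S = "(\<lambda>c z. (0 - c Unit z) / c Level z) ` C"])
    show "finite ((\<lambda>c z. (0 - c Unit z) / c Level z) ` C)"
      using C(1) by (simp add: rational_system_def)
    show "finitely_rational g" if g: "g \<in> (\<lambda>c z. (0 - c Unit z) / c Level z) ` C" for g
    proof -
      obtain c where c: "c \<in> C" "g = (\<lambda>z. (0 - c Unit z) / c Level z)" using g by blast
      have "finitely_rational (c j)" for j using c(1) C(1) by (simp add: rational_system_def)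
      then show ?thesis
        unfolding c(2)
        by (intro finitely_rational_divide finitely_rational_diff finitely_rational_const)
    qed
    show "\<exists>g\<in>(\<lambda>c z. (0 - c Unit z) / c Level z) ` C. f z = g z" for z
      using c(1)[of z]
      by (intro bexI[of _ "\<lambda>z'. (0 - c z Unit z') / c z Level z'"]) (auto simp: f_def)
  qed
  then show ?thesis using c(2) unfolding f_def by blast
qed

section \<open>Continuous selections are piecewise rational\<close>

definition gap :: "ereal \<Rightarrow> ereal \<Rightarrow> real set" where
  "gap a b = {z. a < ereal z \<and> ereal z < b}"

lemma open_gap: "open (gap a b)"
proof -
  have "gap a b = ereal -` {a<..<b}" by (auto simp: gap_def)
  then show ?thesis by (simp add: open_vimage continuous_on_ereal continuous_on_id)
qed

lemma connected_gap: "connected (gap a b)"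
proof -
  have "is_interval (gap a b)"
    unfolding is_interval_1 gap_def
    by (metis (mono_tags, lifting) ereal_less_eq(3) less_le_trans le_less_trans mem_Collect_eq)
  then show ?thesis by (rule is_interval_connected)
qed

lemma mem_closure_gap:
  assumes "a < b" "a \<le> ereal z" "ereal z \<le> b"
  shows "z \<in> closure (gap a b)"
  unfolding closure_approachable
proof (intro allI impI)
  fix e :: real assume e: "e > 0"
  show "\<exists>y\<in>gap a b. dist y z < e"
  proof (cases "ereal z < b")
    case True
    then have "ereal z < min b (ereal (z + e))" using e by simp
    then obtain y where "ereal z < ereal y" "ereal y < min b (ereal (z + e))"
      using ereal_dense2 by blast
    then show ?thesis
      using assms(2) le_less_trans[of a "ereal z" "ereal y"]
      by (intro bexI[of _ y]) (auto simp: gap_def dist_real_def)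
  next
    case False
    then have "max a (ereal (z - e)) < ereal z" using assms e by auto
    then obtain y where "max a (ereal (z - e)) < ereal y" "ereal y < ereal z"
      using ereal_dense2 by blast
    then show ?thesis
      using assms(3) less_le_trans[of "ereal y" "ereal z" b]
      by (intro bexI[of _ y]) (auto simp: gap_def dist_real_def)
  qed
qed

text \<open>
  A finite limit of a rational function at a boundary point means that the reduced fraction has
  no pole there: a common zero of numerator and denominator is divided out until none is left.
\<close>

lemma quotient_on_closure:
  fixes u :: "real \<Rightarrow> real"
  assumes u: "continuous_on UNIV u" and S: "open S"
    and R: "R \<noteq> 0" and eq: "\<forall>z\<in>S. u z * poly R z = poly P z"
  shows "\<exists>P' R'. \<forall>z\<in>closure S. poly R' z \<noteq> 0 \<and> u z = poly P' z / poly R' z"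
  using R eq
proof (induction "degree R" arbitrary: P R rule: less_induct)
  case less
  have extend: "u z * poly R z = poly P z"
    if "\<forall>z\<in>T. u z * poly R z = poly P z" "z \<in> closure T" for T z and P R :: "real poly"
  proof -
    have "closed {z. u z * poly R z = poly P z}"
      using u by (intro closed_Collect_eq continuous_intros)
    then show ?thesis using closure_minimal[of T "{z. u z * poly R z = poly P z}"] that by blast
  qed
  show ?case
  proof (cases "\<exists>z0\<in>closure S. poly R z0 = 0")
    case False
    then show ?thesis
      using extend[OF less.prems(2)] by (intro exI[of _ P] exI[of _ R]) (auto simp: field_simps)
  next
    case True
    then obtain z0 where z0: "z0 \<in> closure S" "poly R z0 = 0" by blast
    then have "poly P z0 = 0" using extend[OF less.prems(2) z0(1)] by simp
    then obtain P1 where P1: "P = [:- z0, 1:] * P1" unfolding poly_eq_0_iff_dvd by (rule dvdE)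
    obtain R1 where R1: "R = [:- z0, 1:] * R1" using z0(2) unfolding poly_eq_0_iff_dvd by (rule dvdE)
    have "R1 \<noteq> 0" using less.prems(1) unfolding R1 by auto
    then have "degree R = Suc (degree R1)" unfolding R1 by (subst degree_mult_eq) auto
    moreover have "u z * poly R1 z = poly P1 z" if z: "z \<in> S" for z
    proof (rule extend)
      have "(z' - z0) * (u z' * poly R1 z') = (z' - z0) * poly P1 z'" if "z' \<in> S" for z'
      proof -
        have "u z' * poly R z' = poly P z'" using less.prems(2) that by blast
        moreover have "poly R z' = (z' - z0) * poly R1 z'" unfolding R1 by (simp add: algebra_simps)
        moreover have "poly P z' = (z' - z0) * poly P1 z'" unfolding P1 by (simp add: algebra_simps)
        ultimately show ?thesis by simp
      qed
      then show "\<forall>z'\<in>S - {z0}. u z' * poly R1 z' = poly P1 z'" by auto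
      show "z \<in> closure (S - {z0})"
      proof (cases "z = z0")
        case True
        then have "z0 islimpt S" using z S by (simp add: interior_limit_point interior_open)
        then show ?thesis unfolding True islimpt_in_closure .
      next
        case False
        then show ?thesis using z closure_subset[of "S - {z0}"] by auto
      qed
    qed
    ultimately show ?thesis by (intro less.hyps[OF _ \<open>R1 \<noteq> 0\<close>]) auto
  qed
qed

text \<open>
  Away from the finitely many points where two of the rational functions cross, the sets on
  which \<open>u\<close> agrees with different ones are disjoint and closed, so a connected set lies in one.
\<close>

lemma finitely_rational_single_quotient:
  fixes u :: "real \<Rightarrow> real"
  assumes u: "continuous_on UNIV u" and fr: "finitely_rational u"
  shows "\<exists>Z. finite Z \<and>
           (\<forall>J. connected J \<and> J \<inter> Z = {} \<longrightarrow>
              (\<exists>P R. R \<noteq> 0 \<and> (\<forall>z\<in>J. u z * poly R z = poly P z)))"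
proof -
  obtain F where F: "finite F" "\<And>z. \<exists>(P, R)\<in>F. poly R z \<noteq> 0 \<and> u z = poly P z / poly R z"
    using fr unfolding finitely_rational_def by blast
  define cross where "cross p q = fst p * snd q - fst q * snd p" for p q :: "real poly \<times> real poly"
  define Z where "Z = (\<Union>p\<in>F. \<Union>q\<in>F. if cross p q = 0 then {} else {z. poly (cross p q) z = 0})"
  define E where "E p = {z. u z * poly (snd p) z = poly (fst p) z}" for p
  have "finite Z" unfolding Z_def using F(1) poly_roots_finite by auto
  moreover have "\<exists>P R. R \<noteq> 0 \<and> (\<forall>z\<in>J. u z * poly R z = poly P z)"
    if J: "connected J" "J \<inter> Z = {}" for J
  proof (cases "J = {}")
    case True
    then show ?thesis by (intro exI[of _ 1]) auto
  next
    case False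
    have sel: "\<exists>q\<in>F. poly (snd q) z \<noteq> 0 \<and> z \<in> E q" for z
    proof -
      obtain P R where "(P, R) \<in> F" "poly R z \<noteq> 0" "u z = poly P z / poly R z"
        using F(2)[of z] by blast
      then show ?thesis by (intro bexI[of _ "(P, R)"]) (auto simp: E_def)
    qed
    obtain z0 where z0: "z0 \<in> J" using False by blast
    obtain p where p: "p \<in> F" "poly (snd p) z0 \<noteq> 0" "z0 \<in> E p" using sel by blast
    define H where "H = {q\<in>F. cross p q \<noteq> 0}"
    define B where "B = (\<Union>q\<in>H. E q)"
    have closed: "closed (E q)" for q
      unfolding E_def using u by (intro closed_Collect_eq continuous_intros)
    have "E p \<inter> B \<inter> J = {}"
    proof -
      have "poly (cross p q) z = 0" if "z \<in> E p" "z \<in> E q" for q z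
      proof -
        have "poly (fst p) z = u z * poly (snd p) z" "poly (fst q) z = u z * poly (snd q) z"
          using that by (simp_all add: E_def)
        then show ?thesis by (simp add: cross_def)
      qed
      then have "z \<in> Z" if "q \<in> H" "z \<in> E p" "z \<in> E q" for q z
        using that p(1) unfolding Z_def H_def by (intro UN_I[of p] UN_I[of q]) auto
      then show ?thesis using J(2) unfolding B_def by blast
    qed
    moreover have "J \<subseteq> E p \<union> B"
    proof
      fix z assume "z \<in> J"
      obtain q where q: "q \<in> F" "poly (snd q) z \<noteq> 0" "z \<in> E q" using sel by blast
      show "z \<in> E p \<union> B"
      proof (cases "cross p q = 0")
        case True
        then have "fst p * snd q = fst q * snd p" unfolding cross_def by simp
        then have "poly (fst p) z * poly (snd q) z = poly (fst q) z * poly (snd p) z"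
          by (simp flip: poly_mult)
        also have "poly (fst q) z = u z * poly (snd q) z" using q(3) by (simp add: E_def)
        finally have "z \<in> E p" using q(2) by (simp add: E_def)
        then show ?thesis by blast
      next
        case False
        then have "q \<in> H" using q(1) by (simp add: H_def)
        then show ?thesis using q(3) unfolding B_def by blast
      qed
    qed
    moreover have "closed B" unfolding B_def H_def using F(1) closed by auto
    ultimately have "E p \<inter> J = {} \<or> B \<inter> J = {}"
      using connected_closedD[OF J(1)] closed by blast
    then have "J \<subseteq> E p" using z0 p(3) \<open>J \<subseteq> E p \<union> B\<close> by blast
    moreover have "snd p \<noteq> 0" using p(2) by auto
    ultimately show ?thesis unfolding E_def by blast
  qed
  ultimately show ?thesis by (intro exI[of _ Z]) simp
qed

lemma breakpoint_interval:
  fixes h :: "nat \<Rightarrow> ereal"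
  assumes "h 1 = - \<infinity>" "h K = \<infinity>" "1 \<le> K"
  shows "\<exists>k\<in>{1..<K}. ereal z \<in> {h k<..h (k + 1)}"
proof -
  define j where "j = (LEAST j. 1 \<le> j \<and> ereal z \<le> h j)"
  have j: "1 \<le> j" "ereal z \<le> h j"
    using LeastI[of "\<lambda>j. 1 \<le> j \<and> ereal z \<le> h j" K] assms unfolding j_def by auto
  have "j \<le> K" unfolding j_def using assms by (intro Least_le) auto
  have "j \<noteq> 1" using j(2) assms(1) by auto
  moreover have "\<not> (1 \<le> j - 1 \<and> ereal z \<le> h (j - 1))"
  proof -
    have "j - 1 < j" using j(1) by simp
    then show ?thesis using not_less_Least[of "j - 1"] unfolding j_def by blast
  qed
  ultimately show ?thesis
    using j \<open>j \<le> K\<close> by (intro bexI[of _ "j - 1"]) auto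
qed

lemma breakpoint_sum:
  fixes h :: "nat \<Rightarrow> ereal" and g :: "nat \<Rightarrow> real"
  assumes mono: "strict_mono_on {1..K} h" and k: "k \<in> {1..<K}" "ereal z \<in> {h k<..h (k + 1)}"
  shows "(\<Sum>j=1..<K. indicator {h j<..h (j + 1)} (ereal z) * g j) = g k"
proof -
  have le: "h i \<le> h j" if "i \<le> j" "i \<in> {1..K}" "j \<in> {1..K}" for i j
    using mono that by (metis strict_mono_on_leD)
  have "ereal z \<notin> {h j<..h (j + 1)}" if j: "j \<in> {1..<K}" "j \<noteq> k" for j
  proof (cases "j < k")
    case True
    then have "h (j + 1) \<le> h k" using j k by (intro le) auto
    then show ?thesis using k(2) by auto
  next
    case False
    then have "h (k + 1) \<le> h j" using j k by (intro le) auto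
    then show ?thesis using k(2) by auto
  qed
  then have "(\<Sum>j=1..<K. indicator {h j<..h (j + 1)} (ereal z) * g j) =
      (\<Sum>j=1..<K. if j = k then g j else 0)"
    using k(2) by (intro sum.cong) (auto simp: indicator_def)
  then show ?thesis using k(1) by simp
qed

text \<open>
  The half-open intervals partition the line, so the sum of indicators means one quotient on each
  interval.
\<close>

lemma piecewise_rational_iff:
  "piecewise_rational u \<longleftrightarrow>
     (\<exists>(K::nat) (h :: nat \<Rightarrow> ereal) Q R.
        1 \<le> K \<and> h 1 = -\<infinity> \<and> h K = \<infinity> \<and> strict_mono_on {1..K} h \<and>
        (\<forall>k\<in>{1..<K}. \<forall>z. ereal z \<in> {h k<..h (k + 1)} \<longrightarrow>
           poly (R k) z \<noteq> 0 \<and> u z = poly (Q k) z / poly (R k) z))"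
  (is "_ \<longleftrightarrow> (\<exists>K h Q R. ?pieces K h Q R)")
proof
  assume "piecewise_rational u"
  then obtain K :: nat and h :: "nat \<Rightarrow> ereal" and Q R where
    h: "1 \<le> K" "h 1 = -\<infinity>" "h K = \<infinity>" "strict_mono_on {1..K} h"
    and R: "\<forall>k\<in>{1..<K}. \<forall>z. ereal z \<in> {h k<..h (k + 1)} \<longrightarrow> poly (R k) z \<noteq> 0"
    and u: "u = (\<lambda>z. \<Sum>k=1..<K.
               indicator {h k<..h (k + 1)} (ereal z) * (poly (Q k) z / poly (R k) z))"
    unfolding piecewise_rational_def by blast
  have "u z = poly (Q k) z / poly (R k) z" if "k \<in> {1..<K}" "ereal z \<in> {h k<..h (k + 1)}" for k z
    unfolding u by (rule breakpoint_sum[OF h(4) that])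
  then have "?pieces K h Q R" using h R by blast
  then show "\<exists>K h Q R. ?pieces K h Q R" by blast
next
  assume "\<exists>K h Q R. ?pieces K h Q R"
  then obtain K :: nat and h :: "nat \<Rightarrow> ereal" and Q R where
    h: "1 \<le> K" "h 1 = -\<infinity>" "h K = \<infinity>" "strict_mono_on {1..K} h"
    and R: "\<And>k z. k \<in> {1..<K} \<Longrightarrow> ereal z \<in> {h k<..h (k + 1)} \<Longrightarrow>
              poly (R k) z \<noteq> 0 \<and> u z = poly (Q k) z / poly (R k) z"
    by blast
  have "u z = (\<Sum>k=1..<K. indicator {h k<..h (k + 1)} (ereal z) * (poly (Q k) z / poly (R k) z))"
    for z
  proof -
    obtain k where k: "k \<in> {1..<K}" "ereal z \<in> {h k<..h (k + 1)}"
      using breakpoint_interval[OF h(2,3,1)] by blast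
    show ?thesis unfolding breakpoint_sum[OF h(4) k] using R[OF k] by blast
  qed
  then have "u = (\<lambda>z. \<Sum>k=1..<K.
               indicator {h k<..h (k + 1)} (ereal z) * (poly (Q k) z / poly (R k) z))"
    by (rule ext)
  then show "piecewise_rational u" unfolding piecewise_rational_def using h R by blast
qed

lemma finite_set_breakpoints:
  fixes Z :: "real set"
  assumes "finite Z"
  shows "\<exists>(K::nat) (h :: nat \<Rightarrow> ereal). 1 \<le> K \<and> h 1 = -\<infinity> \<and> h K = \<infinity> \<and>
           strict_mono_on {1..K} h \<and> (\<forall>k\<in>{1..<K}. gap (h k) (h (k + 1)) \<inter> Z = {})"
proof -
  define zs where "zs = sorted_list_of_set Z"
  define K where "K = length zs + 2"
  define h :: "nat \<Rightarrow> ereal" where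
    "h k = (if k \<le> 1 then -\<infinity> else if k \<ge> K then \<infinity> else ereal (zs ! (k - 2)))" for k
  have zs: "sorted_wrt (<) zs" "set zs = Z"
    using assms by (auto simp: zs_def)
  have mono: "strict_mono_on {1..K} h"
  proof (rule strict_mono_onI)
    fix i j assume ij: "i \<in> {1..K}" "j \<in> {1..K}" "i < j"
    have "zs ! (i - 2) < zs ! (j - 2)" if "1 < i" "j < K"
      using ij that sorted_wrt_nth_less[OF zs(1), of "i - 2" "j - 2"] by (auto simp: K_def)
    then show "h i < h j" using ij by (auto simp: h_def K_def)
  qed
  moreover have "gap (h k) (h (k + 1)) \<inter> Z = {}" if k: "k \<in> {1..<K}" for k
  proof (rule ccontr)
    assume "gap (h k) (h (k + 1)) \<inter> Z \<noteq> {}"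
    then obtain z where z: "z \<in> Z" "h k < ereal z" "ereal z < h (k + 1)"
      by (auto simp: gap_def)
    then obtain i where i: "i < length zs" "z = zs ! i" using zs(2) by (metis in_set_conv_nth)
    then have "h (i + 2) = ereal z" by (simp add: h_def K_def)
    then have "k < i + 2" "i + 2 < k + 1"
      using z k i strict_mono_on_less[OF mono, of k "i + 2"]
        strict_mono_on_less[OF mono, of "i + 2" "k + 1"]
      by (auto simp: K_def)
    then show False by simp
  qed
  ultimately show ?thesis
    by (intro exI[of _ K] exI[of _ h]) (auto simp: h_def K_def)
qed

lemma continuous_finitely_rational_imp_piecewise:
  assumes u: "continuous_on UNIV u" and fr: "finitely_rational u"
  shows "piecewise_rational u"
proof -
  from finitely_rational_single_quotient[OF assms] obtain Z where Z: "finite Z"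
    and single: "\<forall>J. connected J \<and> J \<inter> Z = {} \<longrightarrow>
        (\<exists>P R. R \<noteq> 0 \<and> (\<forall>z\<in>J. u z * poly R z = poly P z))"
    by (elim exE conjE)
  from finite_set_breakpoints[OF Z] obtain K :: nat and h :: "nat \<Rightarrow> ereal" where
    h: "1 \<le> K" "h 1 = -\<infinity>" "h K = \<infinity>" "strict_mono_on {1..K} h"
    and gap: "\<forall>k\<in>{1..<K}. gap (h k) (h (k + 1)) \<inter> Z = {}"
    by (elim exE conjE)
  have "\<exists>p. \<forall>z. ereal z \<in> {h k<..h (k + 1)} \<longrightarrow>
          poly (snd p) z \<noteq> 0 \<and> u z = poly (fst p) z / poly (snd p) z"
    if k: "k \<in> {1..<K}" for k
  proof -
    have "connected (gap (h k) (h (k + 1))) \<and> gap (h k) (h (k + 1)) \<inter> Z = {}"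
      using connected_gap gap k by blast
    from single[rule_format, OF this] obtain P R where
      "R \<noteq> 0" "\<forall>z\<in>gap (h k) (h (k + 1)). u z * poly R z = poly P z"
      by (elim exE conjE)
    from quotient_on_closure[OF u open_gap this] obtain P' R' where
      PR: "\<forall>z\<in>closure (gap (h k) (h (k + 1))). poly R' z \<noteq> 0 \<and> u z = poly P' z / poly R' z"
      by (elim exE)
    have "poly R' z \<noteq> 0 \<and> u z = poly P' z / poly R' z" if "ereal z \<in> {h k<..h (k + 1)}" for z
      using that by (intro PR[rule_format] mem_closure_gap) auto
    then show ?thesis by (intro exI[of _ "(P', R')"]) simp
  qed
  then have "\<forall>k\<in>{1..<K}. \<exists>p. \<forall>z. ereal z \<in> {h k<..h (k + 1)} \<longrightarrow>
      poly (snd p) z \<noteq> 0 \<and> u z = poly (fst p) z / poly (snd p) z" by (rule ballI)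
  from bchoice[OF this] obtain p where p: "\<forall>k\<in>{1..<K}. \<forall>z. ereal z \<in> {h k<..h (k + 1)} \<longrightarrow>
      poly (snd (p k)) z \<noteq> 0 \<and> u z = poly (fst (p k)) z / poly (snd (p k)) z"
    by (elim exE)
  show ?thesis
    unfolding piecewise_rational_iff
    by (rule exI[of _ K], rule exI[of _ h], rule exI[of _ "\<lambda>k. fst (p k)"],
        rule exI[of _ "\<lambda>k. snd (p k)"]) (intro conjI h p)
qed

section \<open>Operations on games with saddle points\<close>

text \<open>
  Explicit optimal strategies of both players are part of the notion, since each construction
  below combines optimal strategies of the given games. The strategies are numbers only to have
  one type for all games; \<open>saddle_value_inj\<close> moves a game to any types that are large enough.
\<close>

definition realizable :: "(real \<Rightarrow> real) \<Rightarrow> bool" where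
  "realizable f \<longleftrightarrow>
     (\<exists>(A :: nat set) (B :: nat set) (G :: nat \<Rightarrow> nat \<Rightarrow> real poly). finite A \<and> finite B \<and>
        (\<forall>z. saddle_value A B (\<lambda>a b. poly (G a b) z) (f z)))"

lemma saddle_value_inj:
  assumes sv: "saddle_value A B M v" and g: "inj_on g A" and k: "inj_on k B"
  shows "saddle_value (g ` A) (k ` B) (\<lambda>a b. M (inv_into A g a) (inv_into B k b)) v"
proof -
  obtain x y where x: "x \<in> mixed_strategies A" "\<forall>b\<in>B. v \<le> (\<Sum>a\<in>A. x a * M a b)"
    and y: "y \<in> mixed_strategies B" "\<forall>a\<in>A. (\<Sum>b\<in>B. y b * M a b) \<le> v"
    using sv unfolding saddle_value_def by blast
  define x' where "x' t = (if t \<in> g ` A then x (inv_into A g t) else 0)" for t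
  define y' where "y' t = (if t \<in> k ` B then y (inv_into B k t) else 0)" for t
  have sumA: "(\<Sum>t\<in>g ` A. x' t * F (inv_into A g t)) = (\<Sum>a\<in>A. x a * F a)" for F
    by (simp add: sum.reindex[OF g] x'_def inv_into_f_f[OF g])
  have sumB: "(\<Sum>t\<in>k ` B. y' t * F (inv_into B k t)) = (\<Sum>b\<in>B. y b * F b)" for F
    by (simp add: sum.reindex[OF k] y'_def inv_into_f_f[OF k])
  have "x' \<in> mixed_strategies (g ` A)"
    using x(1) sumA[of "\<lambda>_. 1"] by (auto simp: mixed_strategies_def x'_def inv_into_f_f[OF g])
  moreover have "y' \<in> mixed_strategies (k ` B)"
    using y(1) sumB[of "\<lambda>_. 1"] by (auto simp: mixed_strategies_def y'_def inv_into_f_f[OF k])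
  moreover have "\<forall>b\<in>k ` B. v \<le> (\<Sum>a\<in>g ` A. x' a * M (inv_into A g a) (inv_into B k b))"
    using x(2) sumA[of "\<lambda>a. M a b" for b] by (auto simp: inv_into_f_f[OF k])
  moreover have "\<forall>a\<in>g ` A. (\<Sum>b\<in>k ` B. y' b * M (inv_into A g a) (inv_into B k b)) \<le> v"
    using y(2) sumB[of "\<lambda>b. M a b" for a] by (auto simp: inv_into_f_f[OF g])
  ultimately show ?thesis unfolding saddle_value_def by blast
qed

lemma realizableI:
  fixes A :: "'a set" and B :: "'b set" and G :: "'a \<Rightarrow> 'b \<Rightarrow> real poly"
  assumes fin: "finite A" "finite B"
    and sv: "\<And>z. saddle_value A B (\<lambda>a b. poly (G a b) z) (f z)"
  shows "realizable f"
proof -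
  obtain g :: "'a \<Rightarrow> nat" where g: "inj_on g A"
    using arb_inj_on_finite_infinite[OF fin(1)] by blast
  obtain k :: "'b \<Rightarrow> nat" where k: "inj_on k B"
    using arb_inj_on_finite_infinite[OF fin(2)] by blast
  have "\<forall>z. saddle_value (g ` A) (k ` B)
      (\<lambda>a b. poly (G (inv_into A g a) (inv_into B k b)) z) (f z)"
    using saddle_value_inj[OF sv g k] by blast
  then show ?thesis
    unfolding realizable_def
    by (intro exI[of _ "g ` A"] exI[of _ "k ` B"]
        exI[of _ "\<lambda>a b. G (inv_into A g a) (inv_into B k b)"]) (simp add: fin)
qed

lemma realizable_imp_value_function:
  assumes "realizable f"
  shows "\<exists>\<Gamma> :: ('a::infinite, 'b::infinite) polynomial_game.
           finite_game \<Gamma> \<and> f = value_function \<Gamma>"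
proof -
  obtain A B :: "nat set" and G where fin: "finite A" "finite B"
    and sv: "\<And>z. saddle_value A B (\<lambda>a b. poly (G a b) z) (f z)"
    using assms unfolding realizable_def by blast
  obtain g :: "nat \<Rightarrow> 'a" where g: "inj_on g A"
    using arb_inj_on_finite_infinite[OF fin(1)] by blast
  obtain k :: "nat \<Rightarrow> 'b" where k: "inj_on k B"
    using arb_inj_on_finite_infinite[OF fin(2)] by blast
  define \<Gamma> :: "('a, 'b) polynomial_game" where
    "\<Gamma> = \<lparr>strategies1 = g ` A, strategies2 = k ` B,
       payoff = (\<lambda>a b. G (inv_into A g a) (inv_into B k b))\<rparr>"
  have "A \<noteq> {}" "B \<noteq> {}"
    using sv unfolding saddle_value_def mixed_strategies_def by auto
  then have game: "finite_game \<Gamma>" unfolding finite_game_def \<Gamma>_def using fin by simp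
  have "f z = value_function \<Gamma> z" for z
  proof -
    have "maxmin_value (strategies1 (game_at \<Gamma> z)) (strategies2 (game_at \<Gamma> z))
        (payoff (game_at \<Gamma> z)) (f z)"
      using saddle_value_imp_maxmin_value[OF saddle_value_inj[OF sv g k]]
      by (simp add: game_at_def \<Gamma>_def)
    moreover have "finite_game (game_at \<Gamma> z)"
      using game by (simp add: finite_game_def game_at_def)
    ultimately show ?thesis unfolding value_function_def using val_eq_maxmin_value by metis
  qed
  then have "f = value_function \<Gamma>" by (rule ext)
  then show ?thesis using game by (intro exI[of _ \<Gamma>] conjI)
qed

lemma realizable_lipschitz_at:
  assumes "realizable f"
  shows "\<exists>p. \<forall>z. \<bar>f z - f h\<bar> \<le> poly p z * \<bar>z - h\<bar>"
proof -
  obtain A B :: "nat set" and G where fin: "finite A" "finite B"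
    and sv: "\<And>z. saddle_value A B (\<lambda>a b. poly (G a b) z) (f z)"
    using assms unfolding realizable_def by blast
  show ?thesis
    by (rule polynomial_value_lipschitz_at[OF fin saddle_value_imp_maxmin_value[OF sv]])
qed

lemma realizable_poly: "realizable (poly p)"
proof (rule realizableI)
  show "saddle_value {()} {()} (\<lambda>a b. poly p z) (poly p z)" for z
    unfolding saddle_value_def mixed_strategies_def
    by (intro bexI[of _ "\<lambda>_. 1"] conjI) auto
qed auto

lemma realizable_neg:
  assumes "realizable f"
  shows "realizable (\<lambda>z. - f z)"
proof -
  obtain A B :: "nat set" and G where fin: "finite A" "finite B"
    and sv: "\<And>z. saddle_value A B (\<lambda>a b. poly (G a b) z) (f z)"
    using assms unfolding realizable_def by blast
  show ?thesis
  proof (rule realizableI[OF fin(2,1)])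
    show "saddle_value B A (\<lambda>b a. poly (- G a b) z) (- f z)" for z
      using sv[of z] unfolding saddle_value_def by (auto simp: sum_negf)
  qed
qed

definition product_strategy :: "('s \<Rightarrow> real) \<Rightarrow> ('t \<Rightarrow> real) \<Rightarrow> 's \<times> 't \<Rightarrow> real" where
  "product_strategy x y = (\<lambda>(s, t). x s * y t)"

lemma product_strategy_sum_fst:
  assumes "y \<in> mixed_strategies T"
  shows "(\<Sum>p\<in>S \<times> T. product_strategy x y p * F (fst p)) = (\<Sum>s\<in>S. x s * F s)"
proof -
  have "(\<Sum>p\<in>S \<times> T. product_strategy x y p * F (fst p)) =
      (\<Sum>s\<in>S. \<Sum>t\<in>T. (x s * F s) * y t)"
    unfolding sum.cartesian_product
    by (intro sum.cong) (auto simp: product_strategy_def)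
  also have "\<dots> = (\<Sum>s\<in>S. x s * F s)"
    using assms by (simp add: mixed_strategies_def flip: sum_distrib_left)
  finally show ?thesis .
qed

lemma product_strategy_sum_snd:
  assumes "x \<in> mixed_strategies S"
  shows "(\<Sum>p\<in>S \<times> T. product_strategy x y p * F (snd p)) = (\<Sum>t\<in>T. y t * F t)"
proof -
  have "(\<Sum>p\<in>S \<times> T. product_strategy x y p * F (snd p)) =
      (\<Sum>s\<in>S. \<Sum>t\<in>T. x s * (y t * F t))"
    unfolding sum.cartesian_product
    by (intro sum.cong) (auto simp: product_strategy_def)
  also have "\<dots> = (\<Sum>s\<in>S. x s) * (\<Sum>t\<in>T. y t * F t)"
    by (simp add: sum_product)
  finally show ?thesis using assms by (simp add: mixed_strategies_def)
qed

lemma product_strategy_mixed: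
  assumes x: "x \<in> mixed_strategies S" and y: "y \<in> mixed_strategies T"
  shows "product_strategy x y \<in> mixed_strategies (S \<times> T)"
proof -
  have "(\<Sum>p\<in>S \<times> T. product_strategy x y p) = 1"
    using product_strategy_sum_fst[OF y, where S = S and x = x and F = "\<lambda>_. 1"] x
    by (simp add: mixed_strategies_def)
  then show ?thesis
    using x y by (auto simp: mixed_strategies_def product_strategy_def)
qed

text \<open>Both games are played at once, independently, and their payoffs are added.\<close>

lemma realizable_add:
  assumes "realizable f1" "realizable f2"
  shows "realizable (\<lambda>z. f1 z + f2 z)"
proof -
  obtain A1 B1 :: "nat set" and G1 where fin1: "finite A1" "finite B1"
    and sv1: "\<And>z. saddle_value A1 B1 (\<lambda>a b. poly (G1 a b) z) (f1 z)"
    using assms(1) unfolding realizable_def by blast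
  obtain A2 B2 :: "nat set" and G2 where fin2: "finite A2" "finite B2"
    and sv2: "\<And>z. saddle_value A2 B2 (\<lambda>a b. poly (G2 a b) z) (f2 z)"
    using assms(2) unfolding realizable_def by blast
  show ?thesis
  proof (rule realizableI)
    fix z
    obtain x1 y1 where x1: "x1 \<in> mixed_strategies A1" "y1 \<in> mixed_strategies B1"
      "\<forall>b\<in>B1. f1 z \<le> (\<Sum>a\<in>A1. x1 a * poly (G1 a b) z)"
      "\<forall>a\<in>A1. (\<Sum>b\<in>B1. y1 b * poly (G1 a b) z) \<le> f1 z"
      using sv1[of z] unfolding saddle_value_def by blast
    obtain x2 y2 where x2: "x2 \<in> mixed_strategies A2" "y2 \<in> mixed_strategies B2"
      "\<forall>b\<in>B2. f2 z \<le> (\<Sum>a\<in>A2. x2 a * poly (G2 a b) z)"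
      "\<forall>a\<in>A2. (\<Sum>b\<in>B2. y2 b * poly (G2 a b) z) \<le> f2 z"
      using sv2[of z] unfolding saddle_value_def by blast
    show "saddle_value (A1 \<times> A2) (B1 \<times> B2)
        (\<lambda>a b. poly (G1 (fst a) (fst b) + G2 (snd a) (snd b)) z) (f1 z + f2 z)"
      unfolding saddle_value_def
    proof (intro bexI conjI ballI)
      show "product_strategy x1 x2 \<in> mixed_strategies (A1 \<times> A2)"
        "product_strategy y1 y2 \<in> mixed_strategies (B1 \<times> B2)"
        using x1(1,2) x2(1,2) by (auto intro: product_strategy_mixed)
      show "f1 z + f2 z \<le> (\<Sum>a\<in>A1 \<times> A2. product_strategy x1 x2 a *
              poly (G1 (fst a) (fst b) + G2 (snd a) (snd b)) z)" if "b \<in> B1 \<times> B2" for b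
        using that x1(3) x2(3)
          product_strategy_sum_fst[OF x2(1), where S = A1 and x = x1 and F = "\<lambda>a. poly (G1 a (fst b)) z"]
          product_strategy_sum_snd[OF x1(1), where T = A2 and y = x2 and F = "\<lambda>a. poly (G2 a (snd b)) z"]
        by (auto simp: distrib_left sum.distrib intro!: add_mono)
      show "(\<Sum>b\<in>B1 \<times> B2. product_strategy y1 y2 b *
              poly (G1 (fst a) (fst b) + G2 (snd a) (snd b)) z) \<le> f1 z + f2 z" if "a \<in> A1 \<times> A2" for a
        using that x1(4) x2(4)
          product_strategy_sum_fst[OF x2(2), where S = B1 and x = y1 and F = "\<lambda>b. poly (G1 (fst a) b) z"]
          product_strategy_sum_snd[OF x1(2), where T = B2 and y = y2 and F = "\<lambda>b. poly (G2 (snd a) b) z"]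
        by (auto simp: distrib_left sum.distrib intro!: add_mono)
    qed
  qed (use fin1 fin2 in auto)
qed

text \<open>
  Player 1 chooses which game counts, while Player 2 must prepare for both and plays an optimal
  strategy in each of them.
\<close>

lemma realizable_max:
  assumes "realizable f1" "realizable f2"
  shows "realizable (\<lambda>z. max (f1 z) (f2 z))"
proof -
  obtain A1 B1 :: "nat set" and G1 where fin1: "finite A1" "finite B1"
    and sv1: "\<And>z. saddle_value A1 B1 (\<lambda>a b. poly (G1 a b) z) (f1 z)"
    using assms(1) unfolding realizable_def by blast
  obtain A2 B2 :: "nat set" and G2 where fin2: "finite A2" "finite B2"
    and sv2: "\<And>z. saddle_value A2 B2 (\<lambda>a b. poly (G2 a b) z) (f2 z)"
    using assms(2) unfolding realizable_def by blast
  define G where "G a b = (case a of Inl a \<Rightarrow> G1 a (fst b) | Inr a \<Rightarrow> G2 a (snd b))" for a b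
  show ?thesis
  proof (rule realizableI)
    fix z
    obtain x1 y1 where x1: "x1 \<in> mixed_strategies A1" "y1 \<in> mixed_strategies B1"
      "\<forall>b\<in>B1. f1 z \<le> (\<Sum>a\<in>A1. x1 a * poly (G1 a b) z)"
      "\<forall>a\<in>A1. (\<Sum>b\<in>B1. y1 b * poly (G1 a b) z) \<le> f1 z"
      using sv1[of z] unfolding saddle_value_def by blast
    obtain x2 y2 where x2: "x2 \<in> mixed_strategies A2" "y2 \<in> mixed_strategies B2"
      "\<forall>b\<in>B2. f2 z \<le> (\<Sum>a\<in>A2. x2 a * poly (G2 a b) z)"
      "\<forall>a\<in>A2. (\<Sum>b\<in>B2. y2 b * poly (G2 a b) z) \<le> f2 z"
      using sv2[of z] unfolding saddle_value_def by blast
    define x where "x = (if f1 z \<le> f2 z then case_sum (\<lambda>_. 0) x2 else case_sum x1 (\<lambda>_. 0))"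
    have sumx: "(\<Sum>a\<in>A1 <+> A2. x a * F a) =
        (if f1 z \<le> f2 z then \<Sum>a\<in>A2. x2 a * F (Inr a) else \<Sum>a\<in>A1. x1 a * F (Inl a))"
      for F :: "nat + nat \<Rightarrow> real"
      using fin1(1) fin2(1) by (simp add: sum.Plus x_def)
    show "saddle_value (A1 <+> A2) (B1 \<times> B2) (\<lambda>a b. poly (G a b) z) (max (f1 z) (f2 z))"
      unfolding saddle_value_def
    proof (intro bexI conjI ballI)
      show "x \<in> mixed_strategies (A1 <+> A2)"
        using x1(1) x2(1) sumx[of "\<lambda>_. 1"]
        by (auto simp: mixed_strategies_def x_def split: sum.split if_splits)
      show "product_strategy y1 y2 \<in> mixed_strategies (B1 \<times> B2)"
        using x1(2) x2(2) by (rule product_strategy_mixed)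
      show "max (f1 z) (f2 z) \<le> (\<Sum>a\<in>A1 <+> A2. x a * poly (G a b) z)" if "b \<in> B1 \<times> B2" for b
        using that x1(3) x2(3) unfolding sumx by (auto simp: G_def)
      show "(\<Sum>b\<in>B1 \<times> B2. product_strategy y1 y2 b * poly (G a b) z) \<le> max (f1 z) (f2 z)"
        if "a \<in> A1 <+> A2" for a
        using that
      proof (rule PlusE)
        fix a1 assume "a1 \<in> A1" "a = Inl a1"
        then show ?thesis
          using x1(4) product_strategy_sum_fst[OF x2(2), where S = B1 and x = y1 and F = "\<lambda>b. poly (G1 a1 b) z"]
          by (auto simp: G_def)
      next
        fix a2 assume "a2 \<in> A2" "a = Inr a2"
        then show ?thesis
          using x2(4) product_strategy_sum_snd[OF x1(2), where T = B2 and y = y2 and F = "\<lambda>b. poly (G2 a2 b) z"]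
          by (auto simp: G_def)
      qed
    qed
  qed (use fin1 fin2 in auto)
qed

lemma realizable_min:
  assumes "realizable f1" "realizable f2"
  shows "realizable (\<lambda>z. min (f1 z) (f2 z))"
proof -
  have "realizable (\<lambda>z. - max (- f1 z) (- f2 z))"
    using assms by (intro realizable_neg realizable_max)
  moreover have "- max (- f1 z) (- f2 z) = min (f1 z) (f2 z)" for z by simp
  ultimately show ?thesis by simp
qed

section \<open>Games with a prescribed quotient as value\<close>

lemma saddle_value_pure:
  assumes fin: "finite A" "finite B" and ij: "i \<in> A" "j \<in> B"
    and saddle: "\<And>b. b \<in> B \<Longrightarrow> v \<le> M i b" "\<And>a. a \<in> A \<Longrightarrow> M a j \<le> v"
  shows "saddle_value A B M v"
  unfolding saddle_value_def
  using pure_strategy_mixed[OF fin(1) ij(1)] pure_strategy_mixed[OF fin(2) ij(2)] saddle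
  by (intro bexI[of _ "pure_strategy i"] bexI[of _ "pure_strategy j"])
    (auto simp: sum_pure_strategy fin ij)

text \<open>
  Under these order relations each player can make the opponent indifferent, and the value is
  the determinant divided by the sum of the cofactors.
\<close>

lemma saddle_value_two_by_two:
  fixes M :: "bool \<Rightarrow> bool \<Rightarrow> real"
  defines "s \<equiv> M True True + M False False - M True False - M False True"
  assumes ord: "M True False \<le> M True True" "M False True \<le> M False False"
    "M True False \<le> M False False" "M False True \<le> M True True" and s: "0 < s"
  shows "saddle_value UNIV UNIV M
           ((M True True * M False False - M True False * M False True) / s)"
proof -
  define x where "x t = (if t then M False False - M False True
    else M True True - M True False) / s" for t
  define y where "y t = (if t then M False False - M True False
    else M True True - M False True) / s" for t
  have "x \<in> mixed_strategies UNIV" "y \<in> mixed_strategies UNIV"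
    using ord s
    by (auto simp: mixed_strategies_def x_def y_def UNIV_bool s_def simp flip: add_divide_distrib)
  moreover have "(\<Sum>t\<in>UNIV. x t * M t b) =
      (M True True * M False False - M True False * M False True) / s" for b
    by (cases b)
      (auto simp: x_def UNIV_bool algebra_simps
        simp flip: add_divide_distrib diff_divide_distrib)
  moreover have "(\<Sum>t\<in>UNIV. y t * M a t) =
      (M True True * M False False - M True False * M False True) / s" for a
    by (cases a)
      (auto simp: y_def UNIV_bool algebra_simps
        simp flip: add_divide_distrib diff_divide_distrib)
  ultimately show ?thesis
    unfolding saddle_value_def by (intro bexI[of _ x] bexI[of _ y]) auto
qed

lemma saddle_value_two_by_two_exists:
  fixes M :: "bool \<Rightarrow> bool \<Rightarrow> real"
  assumes row: "M True False \<le> M True True"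
  shows "\<exists>v. saddle_value UNIV UNIV M v"
proof -
  have pure: "saddle_value UNIV UNIV M (M i j)"
    if "M i j \<le> M i (\<not> j)" "M (\<not> i) j \<le> M i j" for i j
  proof (rule saddle_value_pure)
    show "M i j \<le> M i b" for b using that by (cases "b = j") auto
    show "M a j \<le> M i j" for a using that by (cases "a = i") auto
  qed auto
  consider "M False False \<le> M True False"
    | "M True False \<le> M False False" "M False False \<le> M False True"
    | "M False True \<le> M False False" "M True True \<le> M False True"
    | "M True False < M False False" "M False True < M False False" "M False True < M True True"
    by linarith
  then show ?thesis
  proof cases
    case 1
    then show ?thesis using pure[of True False] row by auto
  next
    case 2
    then show ?thesis using pure[of False False] by auto
  next
    case 3
    then show ?thesis using pure[of False True] by auto
  next
    case 4
    then show ?thesis using saddle_value_two_by_two[of M] row by force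
  qed
qed

text \<open>
  A nonconstant polynomial is large outside a compact part of \<open>I\<close>, and on the compact part its
  absolute value attains a positive minimum.
\<close>

lemma poly_bounded_below_on_closed:
  fixes R :: "real poly"
  assumes I: "closed I" and R: "\<And>z. z \<in> I \<Longrightarrow> poly R z \<noteq> 0"
  shows "\<exists>\<epsilon>>0. \<forall>z\<in>I. \<epsilon> \<le> \<bar>poly R z\<bar>"
proof -
  have "\<exists>\<delta>>0. \<exists>B. \<forall>z\<in>I. B \<le> \<bar>z\<bar> \<longrightarrow> \<delta> \<le> \<bar>poly R z\<bar>"
  proof (cases "degree R = 0")
    case True
    then obtain c where c: "R = [:c:]" by (rule degree_eq_zeroE)
    show ?thesis
    proof (cases "I = {}")
      case False
      then have "0 < \<bar>c\<bar>" using R by (auto simp: c)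
      then show ?thesis by (intro exI[of _ "\<bar>c\<bar>"]) (simp add: c)
    qed (auto intro: exI[of _ 1])
  next
    case False
    then have "filterlim (poly R) at_infinity at_infinity"
      by (intro filterlim_poly_at_infinity) simp
    then have "\<forall>\<^sub>F z in at_infinity. 1 \<le> norm (poly R z)"
      by (simp add: filterlim_at_infinity[of 0])
    then obtain B where "\<forall>z. B \<le> norm z \<longrightarrow> 1 \<le> norm (poly R z)"
      unfolding eventually_at_infinity by blast
    then show ?thesis by (intro exI[of _ 1]) auto
  qed
  then obtain \<delta> B where far: "0 < \<delta>" "\<forall>z\<in>I. B \<le> \<bar>z\<bar> \<longrightarrow> \<delta> \<le> \<bar>poly R z\<bar>"
    by (elim exE conjE)
  define K where "K = I \<inter> cball 0 B"
  have near: "\<exists>\<eta>>0. \<forall>z\<in>K. \<eta> \<le> \<bar>poly R z\<bar>"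
  proof (cases "K = {}")
    case False
    have "compact K" unfolding K_def using I by (intro closed_Int_compact) auto
    moreover have "continuous_on K (\<lambda>z. \<bar>poly R z\<bar>)" by (intro continuous_intros)
    ultimately obtain z0 where "z0 \<in> K" "\<forall>z\<in>K. \<bar>poly R z0\<bar> \<le> \<bar>poly R z\<bar>"
      using continuous_attains_inf[OF _ False] by blast
    then show ?thesis using R[of z0] by (intro exI[of _ "\<bar>poly R z0\<bar>"]) (auto simp: K_def)
  qed (auto intro: exI[of _ 1])
  then obtain \<eta> where \<eta>: "0 < \<eta>" "\<forall>z\<in>K. \<eta> \<le> \<bar>poly R z\<bar>" by (elim exE conjE)
  have "min \<delta> \<eta> \<le> \<bar>poly R z\<bar>" if "z \<in> I" for z
    using that far \<eta> by (cases "B \<le> \<bar>z\<bar>") (auto simp: K_def intro: min.coboundedI1 min.coboundedI2)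
  then show ?thesis using far(1) \<eta>(1) by (intro exI[of _ "min \<delta> \<eta>"]) simp
qed

text \<open>
  Multiplication of both terms by a multiple of \<open>R\<close> turns the quotient into \<open>N / Q\<close> with
  \<open>Q \<ge> 1\<close> on \<open>I\<close>. Let \<open>b = - (1 + N\<^sup>2)\<close> and \<open>r = 2 * (1 + N\<^sup>2)\<close>. The matrix with rows
  \<open>(b + r, b)\<close> and \<open>(c, d)\<close>, where \<open>d = N - b * (Q - 1)\<close> and \<open>c = d - r * (Q - 1)\<close>, has
  determinant \<open>r * N\<close> and cofactor sum \<open>r * Q\<close>, so its mixed solution has the value \<open>N / Q\<close>.
  The order relations for this solution amount to \<open>r \<ge> 0\<close>, \<open>Q \<ge> 1\<close> and \<open>b \<le> N / Q \<le> b + r\<close>.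
  They hold on \<open>I\<close>. At the other points the saddle point comes from \<open>r \<ge> 0\<close>, which orders
  the first row.
\<close>

lemma realizable_quotient_on_closed:
  fixes P R :: "real poly"
  assumes I: "closed I" and R: "\<And>z. z \<in> I \<Longrightarrow> poly R z \<noteq> 0"
  shows "\<exists>f. realizable f \<and> (\<forall>z\<in>I. f z = poly P z / poly R z)"
proof -
  obtain \<epsilon> where \<epsilon>: "0 < \<epsilon>" "\<forall>z\<in>I. \<epsilon> \<le> \<bar>poly R z\<bar>"
    using poly_bounded_below_on_closed[OF assms] by blast
  define N where "N = smult (1 / \<epsilon>\<^sup>2) (P * R)"
  define Q where "Q = smult (1 / \<epsilon>\<^sup>2) (R * R)"
  define b where "b = - (1 + N\<^sup>2)"
  define r where "r = 2 * (1 + N\<^sup>2)"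
  define d where "d = N - b * (Q - 1)"
  define c where "c = d - r * (Q - 1)"
  define G where "G i j = (if i then if j then b + r else b else if j then c else d)" for i j
  define M where "M z i j = poly (G i j) z" for z i j
  have r0: "0 < poly r z" and b0: "poly b z \<le> - \<bar>poly N z\<bar>"
    and br0: "\<bar>poly N z\<bar> \<le> poly (b + r) z" for z
  proof -
    have "0 \<le> (\<bar>poly N z\<bar> - 1)\<^sup>2" by simp
    then have "\<bar>poly N z\<bar> \<le> 1 + (poly N z)\<^sup>2" by (simp add: power2_diff)
    then show "0 < poly r z" "poly b z \<le> - \<bar>poly N z\<bar>" "\<bar>poly N z\<bar> \<le> poly (b + r) z"
      by (auto simp: r_def b_def intro: add_pos_nonneg)
  qed
  have row: "M z True False \<le> M z True True" for z
    using r0[of z] by (simp add: M_def G_def)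
  have quotient: "saddle_value UNIV UNIV (M z) (poly P z / poly R z)" if z: "z \<in> I" for z
  proof -
    have Q1: "1 \<le> poly Q z"
    proof -
      have "\<epsilon>\<^sup>2 \<le> \<bar>poly R z\<bar>\<^sup>2" using \<epsilon> z by (intro power_mono) auto
      then show ?thesis using \<epsilon>(1) by (simp add: Q_def power2_eq_square)
    qed
    have "poly b z * poly Q z \<le> poly b z * 1"
      using Q1 b0[of z] by (intro mult_left_mono_neg) auto
    then have lower: "poly b z * poly Q z \<le> poly N z" using b0[of z] by linarith
    have "poly (b + r) z * 1 \<le> poly (b + r) z * poly Q z"
      using Q1 br0[of z] by (intro mult_left_mono) auto
    then have upper: "poly N z \<le> poly (b + r) z * poly Q z" using br0[of z] by linarith
    have rQ: "0 \<le> poly r z * (poly Q z - 1)" using r0[of z] Q1 by simp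
    have sum: "M z True True + M z False False - M z True False - M z False True =
        poly r z * poly Q z"
      by (simp add: M_def G_def c_def d_def algebra_simps)
    have det: "M z True True * M z False False - M z True False * M z False True =
        poly r z * poly N z"
      by (simp add: M_def G_def c_def d_def algebra_simps)
    have "saddle_value UNIV UNIV (M z) ((poly r z * poly N z) / (poly r z * poly Q z))"
      unfolding sum[symmetric] det[symmetric]
    proof (rule saddle_value_two_by_two[where M = "M z", OF row])
      show "M z False True \<le> M z False False" using rQ by (simp add: M_def G_def c_def)
      show "M z True False \<le> M z False False"
        using lower by (simp add: M_def G_def d_def algebra_simps)
      show "M z False True \<le> M z True True"
        using upper by (simp add: M_def G_def c_def d_def algebra_simps)
      show "0 < M z True True + M z False False - M z True False - M z False True"
        unfolding sum using r0[of z] Q1 by simp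
    qed
    moreover have "(poly r z * poly N z) / (poly r z * poly Q z) = poly P z / poly R z"
      using r0[of z] R[OF z] \<epsilon>(1) by (simp add: N_def Q_def)
    ultimately show ?thesis by simp
  qed
  define f where "f z = (if z \<in> I then poly P z / poly R z
    else SOME v. saddle_value UNIV UNIV (M z) v)" for z
  have "saddle_value UNIV UNIV (M z) (f z)" for z
    using quotient someI_ex[OF saddle_value_two_by_two_exists[of "M z", OF row]]
    by (simp add: f_def)
  then have "realizable f"
    unfolding M_def by (intro realizableI[of UNIV UNIV G]) auto
  moreover have "\<forall>z\<in>I. f z = poly P z / poly R z" by (simp add: f_def)
  ultimately show ?thesis by blast
qed

section \<open>Gluing\<close>

text \<open>
  A realizable function \<open>w\<close> with \<open>w h = 0\<close> satisfies \<open>\<bar>w z\<bar> \<le> p z * \<bar>z - h\<bar>\<close> for a polynomial \<open>p\<close>.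
  Truncation of \<open>w\<close> to the band of half-width \<open>max 0 (p z * (z - h))\<close> therefore changes nothing
  to the right of \<open>h\<close> and gives \<open>0\<close> to the left. For \<open>w = g - f\<close> this is the
  correction that turns \<open>f\<close> into \<open>g\<close> behind \<open>h\<close>.
\<close>

lemma realizable_glue:
  assumes f: "realizable f" and g: "realizable g" and eq: "f h = g h"
  shows "realizable (\<lambda>z. if z \<le> h then f z else g z)"
proof -
  define w where "w z = g z + - f z" for z
  have w: "realizable w"
    unfolding w_def using f g by (intro realizable_add realizable_neg)
  have "w h = 0" using eq by (simp add: w_def)
  then obtain p where p: "\<And>z. \<bar>w z\<bar> \<le> poly p z * \<bar>z - h\<bar>"
    using realizable_lipschitz_at[OF w, of h] by auto
  define q where "q = p * [:- h, 1:]"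
  have q: "poly q z = poly p z * (z - h)" for z by (simp add: q_def algebra_simps)
  define t where
    "t z = max (min (w z) (max (poly 0 z) (poly q z))) (- max (poly 0 z) (poly q z))" for z
  have "realizable t"
    unfolding t_def
    by (intro realizable_max realizable_min realizable_neg realizable_poly w)
  then have "realizable (\<lambda>z. f z + t z)" using f by (rule realizable_add[rotated])
  moreover have "f z + t z = (if z \<le> h then f z else g z)" for z
  proof (cases "z \<le> h")
    case True
    then have "poly q z = - (poly p z * \<bar>z - h\<bar>)" by (simp add: q algebra_simps)
    then have "poly q z \<le> 0" using p[of z] by linarith
    then show ?thesis using True by (simp add: t_def)
  next
    case False
    then have "\<bar>w z\<bar> \<le> poly q z" using p[of z] by (simp add: q)
    then have "t z = w z" by (simp add: t_def)
    then show ?thesis using False by (simp add: w_def)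
  qed
  ultimately show ?thesis by simp
qed

text \<open>
  Each piece is continued to the whole line by the value function of one of the \<open>2 \<times> 2\<close> games,
  which agrees with \<open>u\<close> on the closed interval of the piece. The continuations are glued from
  left to right.
\<close>

lemma piecewise_rational_imp_realizable:
  assumes u: "continuous_on UNIV u" and pw: "piecewise_rational u"
  shows "realizable u"
proof -
  obtain K :: nat and h :: "nat \<Rightarrow> ereal" and Q R where
    h: "1 \<le> K" "h 1 = -\<infinity>" "h K = \<infinity>" "strict_mono_on {1..K} h"
    and R: "\<And>k z. k \<in> {1..<K} \<Longrightarrow> ereal z \<in> {h k<..h (k + 1)} \<Longrightarrow>
              poly (R k) z \<noteq> 0 \<and> u z = poly (Q k) z / poly (R k) z"
    using pw unfolding piecewise_rational_iff by blast
  have "\<exists>w. realizable w \<and> (\<forall>z. ereal z \<le> h n \<longrightarrow> w z = u z)" if "1 \<le> n" "n \<le> K" for n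
    using that
  proof (induction n rule: dec_induct)
    case base
    then show ?case using h(2) realizable_poly by auto
  next
    case (step k)
    then obtain w where w: "realizable w" "\<And>z. ereal z \<le> h k \<Longrightarrow> w z = u z" by auto
    have k: "k \<in> {1..<K}" using step by simp
    define S where "S = gap (h k) (h (k + 1))"
    have lt: "h k < h (k + 1)" using strict_mono_onD[OF h(4)] k by simp
    have "R k \<noteq> 0"
    proof -
      obtain z where "h k < ereal z" "ereal z < h (k + 1)" using ereal_dense2[OF lt] by blast
      then have "ereal z \<in> {h k<..h (k + 1)}" by simp
      then show ?thesis using R[OF k] by fastforce
    qed
    moreover have "\<forall>z\<in>S. u z * poly (R k) z = poly (Q k) z"
      using R[OF k] by (auto simp: S_def gap_def)
    ultimately obtain P' R' where
      PR: "\<And>z. z \<in> closure S \<Longrightarrow> poly R' z \<noteq> 0 \<and> u z = poly P' z / poly R' z"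
      using quotient_on_closure[OF u open_gap] unfolding S_def by blast
    obtain v where v: "realizable v" "\<forall>z\<in>closure S. v z = poly P' z / poly R' z"
      using realizable_quotient_on_closed[of "closure S" R' P'] PR by auto
    have vu: "v z = u z" if "h k \<le> ereal z" "ereal z \<le> h (k + 1)" for z
      using v(2) PR mem_closure_gap[OF lt that] by (simp add: S_def)
    show ?case
    proof (cases "h k")
      case (real r)
      have "w r = v r" using w(2) vu lt real by simp
      then have "realizable (\<lambda>z. if z \<le> r then w z else v z)"
        using w(1) v(1) by (intro realizable_glue)
      then show ?thesis
        using w(2) vu by (intro exI[of _ "\<lambda>z. if z \<le> r then w z else v z"]) (auto simp: real)
    next
      case PInf
      then show ?thesis using lt by simp
    next
      case MInf
      then show ?thesis using v(1) vu by (intro exI[of _ v]) auto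
    qed
  qed
  from this[of K] obtain w where "realizable w" "\<And>z. w z = u z" using h by auto
  moreover from this(2) have "w = u" by (rule ext)
  ultimately show ?thesis by simp
qed

section \<open>Characterisation of the value functions\<close>

theorem theorem2p3:
  "{u :: real \<Rightarrow> real.
      \<exists>\<Gamma> :: ('a::infinite, 'b::infinite) polynomial_game. finite_game \<Gamma> \<and> u = value_function \<Gamma>}
   = {u. continuous_on UNIV u \<and> piecewise_rational u}"
proof (intro set_eqI iffI; unfold mem_Collect_eq)
  fix u
  assume "\<exists>\<Gamma> :: ('a, 'b) polynomial_game. finite_game \<Gamma> \<and> u = value_function \<Gamma>"
  then obtain \<Gamma> :: "('a, 'b) polynomial_game" where fin: "finite_game \<Gamma>"
    and u: "u = value_function \<Gamma>"
    by blast
  note game = fin[unfolded finite_game_def]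
  obtain f where f: "finitely_rational f"
    "\<And>z. maxmin_value (strategies1 \<Gamma>) (strategies2 \<Gamma>) (\<lambda>a b. poly (payoff \<Gamma> a b) z) (f z)"
    using polynomial_value_finitely_rational[of "strategies1 \<Gamma>" "strategies2 \<Gamma>" "payoff \<Gamma>"] game
    by blast
  have "u z = f z" for z
    unfolding u value_function_def
    by (rule val_eq_maxmin_value) (use fin f(2) in \<open>auto simp: finite_game_def game_at_def\<close>)
  then have "u = f" by (rule ext)
  moreover have "continuous_on UNIV f"
    using polynomial_value_continuous[OF _ _ f(2)] game by blast
  ultimately show "continuous_on UNIV u \<and> piecewise_rational u"
    using continuous_finitely_rational_imp_piecewise f(1) by blast
next
  fix u :: "real \<Rightarrow> real"
  assume "continuous_on UNIV u \<and> piecewise_rational u"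
  then show "\<exists>\<Gamma> :: ('a, 'b) polynomial_game. finite_game \<Gamma> \<and> u = value_function \<Gamma>"
    by (intro realizable_imp_value_function piecewise_rational_imp_realizable) auto
qed

end
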